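(* Let $f:(0,\infty)\to\mathbb{R}$ be continuously differentiable with $f(x)>0$ for all $x>0$, $f'(x)>0$ for all $x>x_1$ (for some $x_1\ge 0$), and $f'(x)\to 0$ as $x\to\infty$. Suppose that the limit $$\lambda:=\lim_{x\to\infty}\frac{f(x)}{x/\log x}\in[0,\infty]$$ exists. Let $\mu$ be a positive finite Borel measure on $[0,\infty)$, and put $$M:=\int_{[0,\infty)}\mu(ds)\in(0,\infty),\qquad C:=\int_{[0,\infty)}s\,\mu(ds)\in(0,\infty].$$ Let $\psi>0$ and let $x$ be the unique continuous solution of $$x'(t)=\int_{[0,t]}\mu(ds)\,f(x(t-s)),\quad t\ge 0;\qquad x(0)=\psi.$$ Let $F(x)=\int_1^x \frac{1}{f(u)}\,du$ for $x>0$. (a) We have $$\lim_{t\to\infty}x(t)=+\infty,\qquad \lim_{t\to\infty}\frac{F(x(t))}{t}=M.$$ (b) If $C<+\infty$, then $$\lim_{t\to\infty}\frac{x(t)}{F^{-1}(Mt)}=e^{-\lambda C}.$$ (c) If $C=+\infty$ and $\lambda\in(0,\infty]$, then also $$\lim_{t\to\infty}\frac{x(t)}{F^{-1}(Mt)}=e^{-\lambda C}.$$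
   Context: Convention: $e^{-\infty}:=0$, so the limits in (b) and (c) are $0$ when $\lambda C=+\infty$. The function $F$ is strictly increasing and $F(x)\to\infty$ as $x\to\infty$ (since $f(x)/x\to0$), so $F^{-1}(Mt)$ is defined for all $t\ge0$. Since $\mu$ may have atoms, the solution is understood as a continuous (locally absolutely continuous) function $x:[0,\infty)\to(0,\infty)$ satisfying the equation in integrated form, i.e. for almost every $t\ge0$. *)

theory Defs
  imports "HOL-Analysis.Analysis"
begin

definition delay_rate :: "real measure \<Rightarrow> (real \<Rightarrow> real) \<Rightarrow> (real \<Rightarrow> real) \<Rightarrow> real \<Rightarrow> real" where
  "delay_rate \<mu> f x t = (LINT s:{0..t}|\<mu>. f (x (t - s)))"

text \<open>
  Since \<open>\<mu>\<close> may have atoms, the equation \<open>x'(t) = delay_rate \<mu> f x t\<close> can fail at individual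
  times. A solution is therefore a function that satisfies it in integrated form; this makes it
  locally absolutely continuous, with the differential equation holding for almost every
  \<open>t \<ge> 0\<close>. Only the values of \<open>x\<close> on \<open>[0,\<infinity>)\<close> and of \<open>f\<close> on \<open>(0,\<infinity>)\<close> matter.
\<close>

definition is_solution ::
    "real measure \<Rightarrow> (real \<Rightarrow> real) \<Rightarrow> real \<Rightarrow> (real \<Rightarrow> real) \<Rightarrow> bool" where
  "is_solution \<mu> f \<psi> x \<longleftrightarrow>
     continuous_on {0..} x \<and> (\<forall>t\<ge>0. x t > 0) \<and> x 0 = \<psi> \<and>
     (\<forall>t\<ge>0. set_integrable lborel {0..t} (delay_rate \<mu> f x) \<and>
            x t = \<psi> + (LBINT u:{0..t}. delay_rate \<mu> f x u))"

text \<open>The interval integral is oriented, so \<open>F_int f y < 0\<close> for \<open>0 < y < 1\<close> when \<open>f > 0\<close>.\<close>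

definition F_int :: "(real \<Rightarrow> real) \<Rightarrow> real \<Rightarrow> real" where
  "F_int f y = (LBINT u=ereal 1..ereal y. 1 / f u)"

definition F_inv :: "(real \<Rightarrow> real) \<Rightarrow> real \<Rightarrow> real" where
  "F_inv f = the_inv_into {0<..} (F_int f)"

text \<open>The map \<open>a \<mapsto> e\<^sup>-\<^sup>a\<close> on \<open>[0,\<infinity>]\<close>, with the convention that it vanishes at \<open>\<infinity>\<close>.\<close>

definition exp_neg :: "ennreal \<Rightarrow> real" where
  "exp_neg a = (if a = \<infinity> then 0 else exp (- enn2real a))"

end

theory Submission
  imports Defs
begin

text \<open>
  Write \<open>G(t) = F(x(t))\<close> and \<open>L(t) = ln f(x(t))\<close>. Integrating \<open>x'/f(x)\<close> and applying Fubini gives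
  \<open>G(T) - G(0) = \<integral> J\<^sub>T(s) \<mu>(ds)\<close> with \<open>J\<^sub>T(s) = \<integral>\<^sub>s\<^sup>T exp(-(L(t) - L(t - s))) dt\<close>. Since
  \<open>\<integral> (L(t) - L(t - s)) dt\<close> telescopes to about \<open>s L(T)\<close>, the bounds
  \<open>1 - u \<le> exp(-u)\<close> and, because \<open>f' \<rightarrow> 0\<close> makes \<open>L(t) - L(t - s)\<close> small for bounded \<open>s\<close>,
  \<open>exp(-u) \<le> 1 - (1 - \<delta>) u\<close> yield that \<open>M T - G(T)\<close> is about \<open>C L(T)\<close> (only a lower bound after
  truncating \<open>\<mu>\<close> when \<open>C = \<infinity>\<close>). With \<open>z(t) = F\<^sup>-\<^sup>1(M t)\<close> the left side is \<open>F(z) - F(x)\<close>, which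
  is about \<open>((ln z)\<^sup>2 - (ln x)\<^sup>2) / (2\<lambda>)\<close>, and \<open>L\<close> is about \<open>ln x\<close> when \<open>\<lambda> > 0\<close>; hence
  \<open>ln (z/x) \<rightarrow> \<lambda> C\<close>.
\<close>

section \<open>Elementary inequalities\<close>

lemma ennreal_pos_less_obtain:
  assumes "0 < (q::ennreal)"
  obtains r where "0 < r" "ennreal r < q"
proof -
  obtain y where y: "0 < y" "y < q" using dense assms by blast
  then have "y \<noteq> top" using top.not_eq_extremum by fastforce
  then obtain r where "y = ennreal r" "r \<ge> 0" by (cases y) auto
  then show ?thesis using y that[of r] by simp
qed

text \<open>Since \<open>exp u \<ge> 1 + u\<close>, the left side is at most
  \<open>1 / (1 + u)\<close>, hence at most \<open>1 - u + u * u\<close>. This reverses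
  \<open>1 - u \<le> exp (- u)\<close> up to the factor \<open>1 - \<delta>\<close> in the linear
  term.\<close>

lemma exp_minus_le_linear:
  fixes u \<delta> :: real
  assumes "0 \<le> u" "u \<le> \<delta>"
  shows "exp (- u) \<le> 1 - (1 - \<delta>) * u"
proof -
  have "exp (- u) \<le> 1 / (1 + u)"
    using exp_ge_add_one_self[of u] assms by (simp add: exp_minus field_simps)
  also have "\<dots> \<le> 1 - u + u * u"
    using assms by (simp add: field_simps)
  also have "u * u \<le> \<delta> * u"
    using assms by (intro mult_right_mono)
  finally show ?thesis by (simp add: algebra_simps)
qed

text \<open>The mean value theorem on \<open>[a - s, a]\<close>. It serves for the boundary terms
  that remain when the integral of \<open>L t - L (t - s)\<close> telescopes.\<close>

lemma primitive_increment_bounds: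
  fixes h H :: "real \<Rightarrow> real"
  assumes H: "\<And>t. (H has_real_derivative h t) (at t)" and s: "0 \<le> s"
    and h: "\<And>u. a - s \<le> u \<Longrightarrow> u \<le> a \<Longrightarrow> lo \<le> h u \<and> h u \<le> hi"
  shows "s * lo \<le> H a - H (a - s)" "H a - H (a - s) \<le> s * hi"
proof -
  have "s * lo \<le> H a - H (a - s) \<and> H a - H (a - s) \<le> s * hi"
  proof (cases "s = 0")
    case False
    then obtain z where z: "a - s < z" "z < a" "H a - H (a - s) = (a - (a - s)) * h z"
      using MVT2[of "a - s" a H h] H s by auto
    then show ?thesis using h[of z] s by (auto intro!: mult_left_mono)
  qed simp
  then show "s * lo \<le> H a - H (a - s)" "H a - H (a - s) \<le> s * hi" by auto
qed

section \<open>Sublinear rate functions\<close>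

locale sublinear_rate =
  fixes f :: "real \<Rightarrow> real" and x\<^sub>1 :: real
  assumes f_C1: "f C1_differentiable_on {0<..}"
    and f_pos: "\<And>y. y > 0 \<Longrightarrow> f y > 0"
    and f'_pos: "\<And>y. y > x\<^sub>1 \<Longrightarrow> deriv f y > 0"
    and f'_lim: "(deriv f \<longlongrightarrow> 0) at_top"
begin

lemma f_deriv: "y > 0 \<Longrightarrow> (f has_real_derivative deriv f y) (at y)"
  using f_C1 unfolding C1_differentiable_on_eq
  by (simp add: DERIV_deriv_iff_real_differentiable)

lemma f_cont: "continuous_on {0<..} f"
  by (meson DERIV_isCont continuous_at_imp_continuous_on f_deriv greaterThan_iff)

lemma F_int_deriv:
  assumes "y > 0"
  shows "(F_int f has_real_derivative 1 / f y) (at y)"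
proof -
  \<comment> \<open>The interval must contain the base point 1 of \<open>F_int\<close> and have
    \<open>y\<close> in its interior, so that the derivative within it is a full derivative.\<close>
  define a b where "a = min y 1 / 2" and "b = max y 1 + 1"
  have ab: "0 < a" "a < y" "y < b" "a \<le> 1" "1 \<le> b"
    using assms by (auto simp: a_def b_def min_def max_def)
  have "continuous_on {a..b} (\<lambda>u. 1 / f u)"
    using ab f_pos by (intro continuous_intros continuous_on_subset[OF f_cont]) (force simp: less_le)+
  then have "((\<lambda>u. LBINT y=ereal 1..ereal u. 1 / f y) has_vector_derivative 1 / f y) (at y within {a..b})"
    using ab by (intro interval_integral_FTC2) auto
  then have "(F_int f has_vector_derivative 1 / f y) (at y within {a..b})"
    by (simp add: F_int_def[abs_def])
  moreover have "at y within {a..b} = at y"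
    using ab by (intro at_within_interior) auto
  ultimately show ?thesis
    by (simp add: has_real_derivative_iff_has_vector_derivative)
qed

lemma F_int_strict_mono:
  assumes "0 < a" "a < b"
  shows "F_int f a < F_int f b"
proof (rule DERIV_pos_imp_increasing[OF assms(2)])
  fix u assume "a \<le> u" "u \<le> b"
  then have "u > 0" using assms by simp
  then show "\<exists>y. (F_int f has_real_derivative y) (at u) \<and> 0 < y"
    using F_int_deriv[of u] f_pos[of u] by auto
qed

lemma F_int_less_iff: "0 < a \<Longrightarrow> 0 < b \<Longrightarrow> F_int f a < F_int f b \<longleftrightarrow> a < b"
  using F_int_strict_mono by (metis less_asym linorder_neqE_linordered_idom)

lemma F_int_le_iff: "0 < a \<Longrightarrow> 0 < b \<Longrightarrow> F_int f a \<le> F_int f b \<longleftrightarrow> a \<le> b"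
  using F_int_less_iff by (metis linorder_not_le)

lemma F_int_inj: "inj_on (F_int f) {0<..}"
  by (rule inj_onI) (metis F_int_le_iff greaterThan_iff order_antisym order_refl)

lemma F_int_cont: "continuous_on {0<..} (F_int f)"
  by (meson DERIV_isCont continuous_at_imp_continuous_on F_int_deriv greaterThan_iff)

lemma F_int_1: "F_int f 1 = 0"
  by (simp add: F_int_def)

lemma f_mono:
  assumes "x\<^sub>1 < u" "0 < u" "u \<le> v"
  shows "f u \<le> f v"
proof (rule DERIV_nonneg_imp_nondecreasing[OF assms(3)])
  fix y assume "u \<le> y" "y \<le> v"
  then show "\<exists>d. (f has_real_derivative d) (at y) \<and> 0 \<le> d"
    using f_deriv[of y] f'_pos[of y] assms by (intro exI[of _ "deriv f y"]) auto
qed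

text \<open>Past \<open>q\<close> the function increases, and on the compact interval
  \<open>[p, q]\<close> the quotient of maximum by minimum bounds every loss; that quotient is
  \<open>B\<close>.\<close>

lemma f_quasi_mono:
  assumes "p > 0"
  obtains B where "B \<ge> 1" "\<And>u v. p \<le> u \<Longrightarrow> u \<le> v \<Longrightarrow> f u \<le> B * f v"
proof -
  define q where "q = max p x\<^sub>1 + 1"
  have pq: "p \<le> q" "x\<^sub>1 < q" "q > 0" using assms by (auto simp: q_def)
  have cont: "continuous_on {p..q} f"
    using assms by (intro continuous_on_subset[OF f_cont]) auto
  obtain a where a: "a \<in> {p..q}" "\<And>y. y \<in> {p..q} \<Longrightarrow> f a \<le> f y"
    using continuous_attains_inf[OF _ _ cont] pq by auto
  obtain b where b: "b \<in> {p..q}" "\<And>y. y \<in> {p..q} \<Longrightarrow> f y \<le> f b"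
    using continuous_attains_sup[OF _ _ cont] pq by auto
  have fa: "f a > 0" using a(1) assms by (intro f_pos) auto
  have inf: "f a \<le> f v" if "p \<le> v" for v
    using a(2)[of v] a(2)[of q] f_mono[of q v] pq that by (cases "v \<le> q") auto
  have ab: "f a \<le> f b" using a b by blast
  show ?thesis
  proof (rule that[of "f b / f a"])
    show "f b / f a \<ge> 1" using fa ab by simp
    fix u v assume uv: "p \<le> u" "u \<le> v"
    show "f u \<le> f b / f a * f v"
    proof (cases "u \<le> q")
      case True
      have "f u * f a \<le> f b * f v"
        using b(2)[of u] inf[of v] True uv fa ab by (intro mult_mono) auto
      then show ?thesis using fa by (simp add: field_simps)
    next
      case False
      then have "f u \<le> f v" using f_mono[of u v] uv pq by auto
      moreover have "f v > 0" using uv assms by (intro f_pos) auto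
      ultimately show ?thesis
        using fa ab mult_mono[of 1 "f b / f a" "f u" "f v"] f_pos[of u] uv assms by (auto simp: field_simps)
    qed
  qed
qed

text \<open>The derivative of \<open>ln f\<close> with respect to \<open>F_int f\<close> is
  \<open>deriv f\<close>, which tends to 0; so \<open>\<eta> * F_int f - ln f\<close> is
  nondecreasing as soon as \<open>deriv f < \<eta>\<close>.\<close>

lemma ln_f_increment:
  assumes "\<eta> > 0"
  obtains Y where "Y > 0" "\<And>a b. Y \<le> a \<Longrightarrow> a \<le> b \<Longrightarrow> ln (f b) - ln (f a) \<le> \<eta> * (F_int f b - F_int f a)"
proof -
  have "\<forall>\<^sub>F y in at_top. deriv f y < \<eta>"
    using order_tendstoD(2)[OF f'_lim assms] .
  then obtain Y0 where Y0: "\<And>y. y \<ge> Y0 \<Longrightarrow> deriv f y < \<eta>"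
    by (auto simp: eventually_at_top_linorder)
  define Y where "Y = max Y0 1"
  show ?thesis
  proof (rule that[of Y])
    show "Y > 0" by (simp add: Y_def)
    fix a b assume ab: "Y \<le> a" "a \<le> b"
    have "\<eta> * F_int f a - ln (f a) \<le> \<eta> * F_int f b - ln (f b)"
    proof (rule DERIV_nonneg_imp_nondecreasing[OF ab(2)])
      fix y assume y: "a \<le> y" "y \<le> b"
      then have y0: "y > 0" "y \<ge> Y0" using ab by (auto simp: Y_def)
      have "((\<lambda>y. \<eta> * F_int f y - ln (f y)) has_real_derivative (\<eta> * (1 / f y) - deriv f y / f y)) (at y)"
        using y0 f_pos[of y] by (auto intro!: derivative_eq_intros F_int_deriv f_deriv)
      moreover have "\<eta> * (1 / f y) - deriv f y / f y \<ge> 0"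
        using Y0[of y] y0 f_pos[of y] by (simp add: field_simps)
      ultimately show "\<exists>d. ((\<lambda>y. \<eta> * F_int f y - ln (f y)) has_real_derivative d) (at y) \<and> 0 \<le> d"
        by blast
    qed
    then show "ln (f b) - ln (f a) \<le> \<eta> * (F_int f b - F_int f a)"
      by (simp add: algebra_simps)
  qed
qed

text \<open>Beyond \<open>Y\<close> the difference \<open>ln f - \<eta> * F_int f\<close> does not
  increase, and on the compact remainder it is bounded by continuity.\<close>

lemma ln_f_le_F_int:
  assumes "\<eta> > 0" "p > 0"
  obtains c where "\<And>y. p \<le> y \<Longrightarrow> ln (f y) \<le> \<eta> * F_int f y + c"
proof -
  obtain Y where Y: "Y > 0" "\<And>a b. Y \<le> a \<Longrightarrow> a \<le> b \<Longrightarrow> ln (f b) - ln (f a) \<le> \<eta> * (F_int f b - F_int f a)"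
    using ln_f_increment[OF assms(1)] by metis
  define q where "q = max p Y"
  have pos: "\<And>y. y \<in> {p..q} \<Longrightarrow> f y > 0" using assms by (intro f_pos) auto
  have "continuous_on {p..q} (\<lambda>y. ln (f y) - \<eta> * F_int f y)"
    using assms pos
    by (intro continuous_intros continuous_on_subset[OF f_cont] continuous_on_subset[OF F_int_cont])
       (force simp: less_le)+
  then obtain b where b: "b \<in> {p..q}"
    "\<And>y. y \<in> {p..q} \<Longrightarrow> ln (f y) - \<eta> * F_int f y \<le> ln (f b) - \<eta> * F_int f b"
    using continuous_attains_sup[of "{p..q}" "\<lambda>y. ln (f y) - \<eta> * F_int f y"] by (auto simp: q_def)
  have "ln (f y) \<le> \<eta> * F_int f y + (ln (f b) - \<eta> * F_int f b)" if "p \<le> y" for y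
  proof (cases "y \<le> q")
    case True
    then show ?thesis using b(2)[of y] that by simp
  next
    case False
    then have "q \<le> y" "q \<in> {p..q}" "Y \<le> q" by (auto simp: q_def)
    then show ?thesis using b(2)[of q] Y(2)[of q y] by (simp add: algebra_simps)
  qed
  then show ?thesis by (rule that)
qed

text \<open>\<open>(ln u)\<^sup>2 / (2 * l)\<close> is a primitive of \<open>ln u / (l * u)\<close>,
  the reciprocal of the comparison rate \<open>l * u / ln u\<close>, so a pointwise comparison of
  derivatives suffices. Reversing it gives the lower bound that follows.\<close>

lemma F_int_diff_le_ln_squares:
  assumes "l > 0" "1 < a" "a \<le> b" and f: "\<And>u. a \<le> u \<Longrightarrow> l * u / ln u \<le> f u"
  shows "F_int f b - F_int f a \<le> ((ln b)\<^sup>2 - (ln a)\<^sup>2) / (2 * l)"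
proof -
  have "(ln a)\<^sup>2 / (2 * l) - F_int f a \<le> (ln b)\<^sup>2 / (2 * l) - F_int f b"
  proof (rule DERIV_nonneg_imp_nondecreasing[OF assms(3)])
    fix u assume u: "a \<le> u" "u \<le> b"
    have D: "((\<lambda>u. (ln u)\<^sup>2 / (2 * l) - F_int f u) has_real_derivative ln u / (l * u) - 1 / f u) (at u)"
      using u assms by (auto intro!: derivative_eq_intros F_int_deriv simp: field_simps)
    have "1 / f u \<le> 1 / (l * u / ln u)"
      using f[OF u(1)] u assms by (intro divide_left_mono mult_pos_pos f_pos divide_pos_pos) auto
    then show "\<exists>d. ((\<lambda>u. (ln u)\<^sup>2 / (2 * l) - F_int f u) has_real_derivative d) (at u) \<and> 0 \<le> d"
      using D by (intro exI[of _ "ln u / (l * u) - 1 / f u"]) auto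
  qed
  then show ?thesis by (simp add: diff_divide_distrib)
qed

lemma F_int_diff_ge_ln_squares:
  assumes "l > 0" "1 < a" "a \<le> b" and f: "\<And>u. a \<le> u \<Longrightarrow> f u \<le> l * u / ln u"
  shows "((ln b)\<^sup>2 - (ln a)\<^sup>2) / (2 * l) \<le> F_int f b - F_int f a"
proof -
  have "F_int f a - (ln a)\<^sup>2 / (2 * l) \<le> F_int f b - (ln b)\<^sup>2 / (2 * l)"
  proof (rule DERIV_nonneg_imp_nondecreasing[OF assms(3)])
    fix u assume u: "a \<le> u" "u \<le> b"
    have D: "((\<lambda>u. F_int f u - (ln u)\<^sup>2 / (2 * l)) has_real_derivative 1 / f u - ln u / (l * u)) (at u)"
      using u assms by (auto intro!: derivative_eq_intros F_int_deriv simp: field_simps)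
    have "1 / (l * u / ln u) \<le> 1 / f u"
      using f[OF u(1)] u assms by (intro divide_left_mono mult_pos_pos f_pos divide_pos_pos) auto
    then show "\<exists>d. ((\<lambda>u. F_int f u - (ln u)\<^sup>2 / (2 * l)) has_real_derivative d) (at u) \<and> 0 \<le> d"
      using D by (intro exI[of _ "1 / f u - ln u / (l * u)"]) auto
  qed
  then show ?thesis by (simp add: diff_divide_distrib)
qed

text \<open>With \<open>w = ln u\<close>, the logarithm of \<open>l * u / ln u\<close> is
  \<open>ln l + w - ln w\<close>. Both corrections are o(w); each may cost \<open>b * w\<close>,
  where \<open>b\<close> is half of the available \<open>1 - a\<close>.\<close>

lemma ln_f_lower:
  assumes "l > 0" "a < 1" and f: "\<forall>\<^sub>F u in at_top. l * u / ln u \<le> f u"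
  shows "\<forall>\<^sub>F u in at_top. a * ln u \<le> ln (f u)"
proof -
  define b where "b = (1 - a) / 2"
  have b: "b > 0" using assms by (simp add: b_def)
  have "\<forall>\<^sub>F w in at_top. ln w / w < b"
    using ln_x_over_x_tendsto_0 b by (rule order_tendstoD)
  then have "\<forall>\<^sub>F w in at_top. a * w \<le> ln l + w - ln w"
    using eventually_gt_at_top[of 0] eventually_ge_at_top[of "- ln l / b"]
  proof eventually_elim
    case (elim w)
    then have "ln w < b * w" "- ln l \<le> b * w" using b by (auto simp: field_simps)
    moreover have "a * w = w - b * w - b * w" by (simp add: b_def field_simps)
    ultimately show ?case by linarith
  qed
  then have "\<forall>\<^sub>F u in at_top. a * ln u \<le> ln l + ln u - ln (ln u)"
    using ln_at_top by (rule eventually_compose_filterlim)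
  then show ?thesis
    using f eventually_gt_at_top[of 1]
  proof eventually_elim
    case (elim u)
    then have "ln l + ln u - ln (ln u) = ln (l * u / ln u)"
      using assms by (simp add: ln_mult ln_div)
    also have "\<dots> \<le> ln (f u)" using elim assms by (intro ln_mono) auto
    finally show ?case using elim by simp
  qed
qed

lemma f_ge_of_limit:
  assumes "((\<lambda>y. ennreal (f y / (y / ln y))) \<longlongrightarrow> lam) at_top" "0 \<le> l" "ennreal l < lam"
  shows "\<forall>\<^sub>F u in at_top. l * u / ln u \<le> f u"
  using order_tendstoD(1)[OF assms(1,3)] eventually_gt_at_top[of 1]
proof eventually_elim
  case (elim u)
  then have "l < f u / (u / ln u)" using assms(2) by (simp add: ennreal_less_iff)
  then show ?case using elim by (simp add: field_simps)
qed

lemma f_le_of_limit: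
  assumes "((\<lambda>y. ennreal (f y / (y / ln y))) \<longlongrightarrow> lam) at_top" "lam < ennreal l"
  shows "\<forall>\<^sub>F u in at_top. f u \<le> l * u / ln u"
  using order_tendstoD(2)[OF assms(1,2)] eventually_gt_at_top[of 1]
proof eventually_elim
  case (elim u)
  then have "0 \<le> f u / (u / ln u)" using f_pos[of u] by simp
  then have "f u / (u / ln u) < l" using elim by (simp add: ennreal_less_iff)
  then show ?case using elim by (simp add: field_simps)
qed

end

section \<open>The integral equation\<close>

text \<open>The parameter \<open>B\<close> is the constant that \<open>f_quasi_mono\<close> provides for \<open>p = \<psi>\<close>.\<close>

locale delay_solution = sublinear_rate +
  fixes x :: "real \<Rightarrow> real" and \<mu> :: "real measure" and \<psi> M B :: real
  assumes mu_sets: "sets \<mu> = sets (restrict_space borel {0..})"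
    and mu_finite: "finite_measure \<mu>"
    and M: "M = measure \<mu> {0..}" "M > 0"
    and psi: "\<psi> > 0"
    and x: "is_solution \<mu> f \<psi> x"
    and B: "B \<ge> 1" "\<And>u v. \<psi> \<le> u \<Longrightarrow> u \<le> v \<Longrightarrow> f u \<le> B * f v"
begin

interpretation mu: finite_measure \<mu> by (rule mu_finite)

interpretation pair_sigma_finite \<mu> lborel ..

lemma space_mu: "space \<mu> = {0..}"
  using sets_eq_imp_space_eq[OF mu_sets] by (simp add: space_restrict_space)

lemma ident_mu_measurable: "(\<lambda>s. s) \<in> borel_measurable \<mu>"
  unfolding measurable_cong_sets[OF mu_sets refl] by (rule measurable_restrict_space1) simp

lemma integral_mu_const: "(\<integral>s. c \<partial>\<mu>) = M * c"
  by (simp add: space_mu flip: M(1))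

lemma x_cont: "continuous_on {0..} x" and x_pos: "t \<ge> 0 \<Longrightarrow> x t > 0" and x_0: "x 0 = \<psi>"
  using x unfolding is_solution_def by blast+

abbreviation rate where "rate \<equiv> delay_rate \<mu> f x"

text \<open>Freezing the argument at 0 for negative times makes \<open>g\<close> positive and
  continuous on the whole line, so that shifts \<open>g (t - s)\<close> need no side
  conditions.\<close>

definition g where "g t = f (x (max 0 t))"

lemma g_nonneg_eq: "t \<ge> 0 \<Longrightarrow> g t = f (x t)"
  by (simp add: g_def)

lemma g_pos: "g t > 0"
  unfolding g_def by (intro f_pos x_pos) auto

lemma g_nonzero [simp]: "g t \<noteq> 0"
  using g_pos[of t] by simp

lemma g_cont: "continuous_on A g"
proof -
  have "continuous_on UNIV (\<lambda>t. x (max 0 t))"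
    by (rule continuous_on_compose2[OF x_cont, of UNIV "\<lambda>t. max 0 t"]) (intro continuous_intros, auto)
  then have "continuous_on UNIV g"
    unfolding g_def by (rule continuous_on_compose2[OF f_cont]) (auto intro!: x_pos)
  then show ?thesis by (rule continuous_on_subset) auto
qed

lemma g_measurable [measurable]: "g \<in> borel_measurable borel"
  by (rule borel_measurable_continuous_onI[OF g_cont])

section \<open>Monotonicity of the solution and the kernel f(x(t - s)) / f(x(t))\<close>

lemma rate_nonneg: "rate t \<ge> 0"
  unfolding delay_rate_def set_lebesgue_integral_def
  by (intro Bochner_Integration.integral_nonneg)
     (auto simp: indicator_def intro!: less_imp_le[OF f_pos] x_pos)

lemma rate_has_integral:
  assumes "0 \<le> a" "a \<le> b"
  shows "(rate has_integral (x b - x a)) {a..b}"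
proof -
  have *: "rate integrable_on {0..t}" "integral {0..t} rate = x t - \<psi>" if "t \<ge> 0" for t
  proof -
    have "set_integrable lborel {0..t} rate" "x t = \<psi> + (LBINT u:{0..t}. rate u)"
      using x that unfolding is_solution_def by blast+
    then show "rate integrable_on {0..t}" "integral {0..t} rate = x t - \<psi>"
      using set_borel_integral_eq_integral[of "{0..t}" rate] by simp_all
  qed
  have "rate integrable_on {a..b}"
    using *(1)[of b] assms by (auto intro: integrable_subinterval_real)
  moreover have "integral {a..b} rate = x b - x a"
    using Henstock_Kurzweil_Integration.integral_combine[of 0 a b rate] * assms by simp
  ultimately show ?thesis using integrable_integral[of rate "{a..b}"] by simp
qed

lemma x_mono: "0 \<le> a \<Longrightarrow> a \<le> b \<Longrightarrow> x a \<le> x b"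
  using has_integral_nonneg[OF rate_has_integral rate_nonneg] by simp

lemma x_ge_psi: "0 \<le> t \<Longrightarrow> \<psi> \<le> x t"
  using x_mono[of 0 t] x_0 by simp

lemma g_quasi_mono: "s \<le> t \<Longrightarrow> g s \<le> B * g t"
  unfolding g_def by (intro B x_ge_psi x_mono) auto

text \<open>For \<open>s \<ge> 0\<close> this is f(x(t - s)) / f(x(t)) on
  \<open>s \<le> t \<le> T\<close>, extended by zero. The cut-offs are part of the function so that
  Fubini applies on the full product of \<open>\<mu>\<close> and Lebesgue measure.\<close>

definition ratio where
  "ratio T s t = indicator {0..T} t * (indicator {0..} (t - s) * (g (t - s) / g t))"

lemma ratio_nonneg: "0 \<le> ratio T s t"
  using g_pos by (auto simp: ratio_def indicator_def less_imp_le)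

lemma ratio_le: "0 \<le> s \<Longrightarrow> ratio T s t \<le> B * indicator {0..T} t"
  using g_pos[of t] g_quasi_mono[of "t - s" t] B(1) by (auto simp: ratio_def indicator_def field_simps)

lemma ratio_le_B: "0 \<le> s \<Longrightarrow> ratio T s t \<le> B"
  using B(1) by (intro order_trans[OF ratio_le]) (auto simp: indicator_def)

lemma ratio_measurable: "(\<lambda>(s, t). ratio T s t) \<in> borel_measurable (\<mu> \<Otimes>\<^sub>M lborel)"
proof -
  have [measurable]: "fst \<in> borel_measurable (\<mu> \<Otimes>\<^sub>M lborel)"
    using measurable_compose[OF measurable_fst ident_mu_measurable] .
  have [measurable]: "snd \<in> borel_measurable (\<mu> \<Otimes>\<^sub>M lborel)"
    using measurable_snd[of \<mu> lborel] by simp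
  show ?thesis
    unfolding ratio_def case_prod_beta by measurable
qed

text \<open>The kernel is bounded by \<open>B\<close> and vanishes off
  \<open>space \<mu> \<times> {0..T}\<close>, whose product measure is finite.\<close>

lemma ratio_integrable: "integrable (\<mu> \<Otimes>\<^sub>M lborel) (\<lambda>(s, t). ratio T s t)"
proof (rule Bochner_Integration.integrable_bound[OF _ ratio_measurable])
  have "emeasure (\<mu> \<Otimes>\<^sub>M lborel) (space \<mu> \<times> {0..T}) = emeasure \<mu> (space \<mu>) * emeasure lborel {0..T}"
    by (rule lborel.emeasure_pair_measure_Times) auto
  also have "\<dots> < \<infinity>"
    unfolding infinity_ennreal_def using mu.emeasure_finite[of "space \<mu>"]
    by (intro ennreal_mult_less_top[THEN iffD2] disjI2 conjI) (simp_all add: emeasure_lborel_Icc_eq less_top[symmetric])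
  finally show "integrable (\<mu> \<Otimes>\<^sub>M lborel) (\<lambda>p. B * indicator (space \<mu> \<times> {0..T}) p)"
    by (intro integrable_mult_right integrable_real_indicator) auto
  show "AE p in \<mu> \<Otimes>\<^sub>M lborel. norm (case p of (s, t) \<Rightarrow> ratio T s t)
      \<le> norm (B * indicator (space \<mu> \<times> {0..T}) p)"
  proof (rule AE_I2)
    fix p :: "real \<times> real" assume "p \<in> space (\<mu> \<Otimes>\<^sub>M lborel)"
    then have "fst p \<ge> 0" "fst p \<in> space \<mu>" by (auto simp: space_pair_measure space_mu)
    then show "norm (case p of (s, t) \<Rightarrow> ratio T s t) \<le> norm (B * indicator (space \<mu> \<times> {0..T}) p)"
      using ratio_le[of "fst p" T "snd p"] ratio_nonneg[of T "fst p" "snd p"] B(1)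
      by (cases p) (auto simp: indicator_def)
  qed
qed

lemma rate_over_g_eq:
  "indicator {0..T} t * (rate t / g t) = (\<integral>s. ratio T s t \<partial>\<mu>)"
proof (cases "t \<in> {0..T}")
  case True
  have "rate t / g t = (\<integral>s. indicator {0..t} s * f (x (t - s)) / g t \<partial>\<mu>)"
    unfolding delay_rate_def set_lebesgue_integral_def by simp
  also have "\<dots> = (\<integral>s. ratio T s t \<partial>\<mu>)"
    using True by (intro Bochner_Integration.integral_cong)
                  (auto simp: space_mu ratio_def indicator_def g_def max_def)
  finally show ?thesis using True by simp
qed (simp add: ratio_def)

lemma ratio_bound_integrable: "integrable \<mu> (\<lambda>s. ratio T s t)"
proof (rule mu.integrable_const_bound)
  show "AE s in \<mu>. norm (ratio T s t) \<le> B"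
  proof (rule AE_I2)
    fix s assume "s \<in> space \<mu>"
    then show "norm (ratio T s t) \<le> B"
      using ratio_le_B[of s T t] ratio_nonneg[of T s t] by (simp add: space_mu)
  qed
  have [measurable]: "(\<lambda>s. s) \<in> borel_measurable \<mu>" by (rule ident_mu_measurable)
  show "(\<lambda>s. ratio T s t) \<in> borel_measurable \<mu>"
    unfolding ratio_def by measurable
qed

lemma rate_le:
  assumes "t \<ge> 0"
  shows "rate t \<le> M * B * g t"
proof -
  have "rate t / g t = (\<integral>s. ratio t s t \<partial>\<mu>)"
    using rate_over_g_eq[of t t] assms by simp
  also have "\<dots> \<le> (\<integral>s. B \<partial>\<mu>)"
  proof (rule integral_mono[OF ratio_bound_integrable])
    show "ratio t s t \<le> B" if "s \<in> space \<mu>" for s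
      using ratio_le_B that by (simp add: space_mu)
  qed simp
  finally have "rate t / g t \<le> M * B" by (simp only: integral_mu_const)
  then show ?thesis using g_pos[of t] by (simp add: field_simps)
qed

lemma rate_over_g_set_integrable: "set_integrable lborel {0..T} (\<lambda>t. rate t / g t)"
  using integrable_snd[OF ratio_integrable[of T]]
  unfolding set_integrable_def real_scaleR_def rate_over_g_eq by simp

lemma rate_over_g_integrable: "0 \<le> a \<Longrightarrow> (\<lambda>t. rate t / g t) integrable_on {a..b}"
  using set_borel_integral_eq_integral(1)[OF rate_over_g_set_integrable[of b]]
  by (rule integrable_subinterval_real) auto

text \<open>The mean value theorem gives \<open>(x b - x a) / f z\<close>, and
  \<open>z = x w\<close> with \<open>w\<close> in \<open>[a, b]\<close> by continuity. As
  \<open>x b - x a\<close> is the integral of \<open>rate\<close>, the error is the integral of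
  \<open>rate t * (1 / g w - 1 / g t)\<close>, which the oscillation of \<open>1 / g\<close>
  controls.\<close>

lemma F_int_increment:
  assumes ab: "0 \<le> a" "a \<le> b" and e: "\<And>u v. u \<in> {a..b} \<Longrightarrow> v \<in> {a..b} \<Longrightarrow> \<bar>1 / g u - 1 / g v\<bar> \<le> e"
  shows "\<bar>F_int f (x b) - F_int f (x a) - integral {a..b} (\<lambda>t. rate t / g t)\<bar> \<le> e * (x b - x a)"
proof -
  have "\<exists>w\<in>{a..b}. F_int f (x b) - F_int f (x a) = (x b - x a) * (1 / g w)"
  proof (cases "x a < x b")
    case True
    obtain z where z: "x a < z" "z < x b" "F_int f (x b) - F_int f (x a) = (x b - x a) * (1 / f z)"
      using MVT2[OF True, of "F_int f" "\<lambda>z. 1 / f z"] F_int_deriv x_pos[of a] ab by force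
    have "continuous_on {a..b} x" using ab by (intro continuous_on_subset[OF x_cont]) auto
    then obtain w where "a \<le> w" "w \<le> b" "x w = z"
      using IVT'[of x a z b] z ab by auto
    then show ?thesis using z(3) ab by (intro bexI[of _ w]) (auto simp: g_nonneg_eq)
  next
    case False
    then have "x a = x b" using x_mono[OF ab] by simp
    then show ?thesis using ab by (intro bexI[of _ a]) auto
  qed
  then obtain w where w: "w \<in> {a..b}" "F_int f (x b) - F_int f (x a) = (x b - x a) * (1 / g w)"
    by blast
  have r: "(rate has_integral (x b - x a)) {a..b}" by (rule rate_has_integral[OF ab])
  have k: "((\<lambda>t. rate t / g t) has_integral integral {a..b} (\<lambda>t. rate t / g t)) {a..b}"
    using rate_over_g_integrable ab by (intro integrable_integral) auto
  have d: "((\<lambda>t. rate t * (1 / g w) - rate t / g t) has_integral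
       ((x b - x a) * (1 / g w) - integral {a..b} (\<lambda>t. rate t / g t))) {a..b}"
    by (intro has_integral_diff has_integral_mult_left r k)
  have "norm (rate t * (1 / g w) - rate t / g t) \<le> rate t * e" if "t \<in> {a..b}" for t
  proof -
    have "rate t * (1 / g w) - rate t / g t = rate t * (1 / g w - 1 / g t)"
      by (simp add: algebra_simps)
    then show ?thesis
      using e[OF w(1) that] rate_nonneg[of t] by (simp add: abs_mult mult_left_mono)
  qed
  then have "norm (integral {a..b} (\<lambda>t. rate t * (1 / g w) - rate t / g t)) \<le> integral {a..b} (\<lambda>t. rate t * e)"
    using d has_integral_mult_left[OF r, of e]
    by (intro integral_norm_bound_integral) (auto simp: has_integral_integrable)
  then show ?thesis
    using integral_unique[OF d] integral_unique[OF has_integral_mult_left[OF r, of e]] w(2)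
    by (simp add: mult.commute del: integral_mult_left integral_mult_right)
qed

text \<open>The rate need not be continuous, so the chain rule is obtained by showing that the
  difference of both sides has derivative zero everywhere.\<close>

lemma F_int_x_eq_integral:
  assumes T: "0 \<le> T"
  shows "F_int f (x T) - F_int f \<psi> = integral {0..T} (\<lambda>t. rate t / g t)"
proof -
  define k where "k = (\<lambda>t. rate t / g t)"
  define W where "W = (\<lambda>t. F_int f (x t) - integral {0..t} k)"
  obtain K where K: "K > 0" "\<And>t. t \<in> {0..T} \<Longrightarrow> g t \<le> K"
  proof -
    have "\<exists>a\<in>{0..T}. \<forall>t\<in>{0..T}. g t \<le> g a"
      using T by (intro continuous_attains_sup g_cont) auto
    then show ?thesis using that g_pos by blast
  qed
  \<comment> \<open>An increment of \<open>W\<close> costs the oscillation of \<open>1 / g\<close>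
    times a multiple of the length; the oscillation vanishes as the interval shrinks to a
    point.\<close>
  have incr: "\<bar>W b - W a\<bar> \<le> e * (M * B * K * (b - a))"
    if ab: "0 \<le> a" "a \<le> b" "b \<le> T" and "e \<ge> 0"
      and e: "\<And>u v. u \<in> {a..b} \<Longrightarrow> v \<in> {a..b} \<Longrightarrow> \<bar>1 / g u - 1 / g v\<bar> \<le> e" for a b e
  proof -
    have "integral {0..a} k + integral {a..b} k = integral {0..b} k"
      unfolding k_def using ab
      by (intro Henstock_Kurzweil_Integration.integral_combine rate_over_g_integrable) auto
    then have "\<bar>W b - W a\<bar> \<le> e * (x b - x a)"
      using F_int_increment[OF ab(1,2) e] by (simp add: W_def k_def)
    also have "x b - x a \<le> M * B * K * (b - a)"
    proof (rule has_integral_le[OF rate_has_integral[OF ab(1,2)]])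
      show "((\<lambda>t. M * B * K) has_integral M * B * K * (b - a)) {a..b}"
        using has_integral_const_real[of "M * B * K" a b] ab by (simp add: mult.commute)
      fix t assume "t \<in> {a..b}"
      then have "rate t \<le> M * B * g t" "g t \<le> K" using rate_le[of t] K(2)[of t] ab by auto
      moreover have "M * B * g t \<le> M * B * K" using \<open>g t \<le> K\<close> M(2) B(1) by (intro mult_left_mono) auto
      ultimately show "rate t \<le> M * B * K" by simp
    qed
    finally show ?thesis using \<open>e \<ge> 0\<close> by (simp add: mult_left_mono)
  qed
  have "(W has_real_derivative 0) (at t within {0..T})" if t: "t \<in> {0..T}" for t
    unfolding has_field_derivative_iff
  proof (rule tendstoI)
    fix e :: real assume "e > 0"
    \<comment> \<open>Chosen so that \<open>2 * e' * (M * B * K) = e / 2\<close>: the factor 2 comes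
      from comparing two values of \<open>1 / g\<close> through its value at \<open>t\<close>, and
      the spare half makes the inequality strict.\<close>
    define e' where "e' = e / (4 * (M * B * K))"
    have MBK: "M * B * K > 0" using M(2) B(1) K(1) by simp
    have "e' > 0" using \<open>e > 0\<close> MBK by (simp add: e'_def)
    have "continuous_on UNIV (\<lambda>t. 1 / g t)"
      by (intro continuous_intros g_cont) simp
    then have "isCont (\<lambda>t. 1 / g t) t" by (simp add: continuous_on_eq_continuous_at)
    then obtain d where d: "d > 0" "\<And>u. \<bar>u - t\<bar> < d \<Longrightarrow> \<bar>1 / g u - 1 / g t\<bar> < e'"
      using \<open>e' > 0\<close> by (auto simp: continuous_at_eps_delta dist_real_def)
    have "\<bar>(W y - W t) / (y - t)\<bar> < e" if y: "y \<in> {0..T}" "y \<noteq> t" "\<bar>y - t\<bar> < d" for y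
    proof -
      have "\<bar>W (max y t) - W (min y t)\<bar> \<le> 2 * e' * (M * B * K * (max y t - min y t))"
      proof (rule incr)
        fix u v assume "u \<in> {min y t..max y t}" "v \<in> {min y t..max y t}"
        then have "\<bar>u - t\<bar> < d" "\<bar>v - t\<bar> < d" using y by (auto simp: min_def max_def split: if_splits)
        then show "\<bar>1 / g u - 1 / g v\<bar> \<le> 2 * e'" using d(2)[of u] d(2)[of v] by linarith
      qed (use y t \<open>e' > 0\<close> in auto)
      also have "\<dots> = e / 2 * (max y t - min y t)"
      proof -
        have "2 * e' * (M * B * K) = e / 2" using MBK unfolding e'_def by (simp only: field_simps) auto
        then show ?thesis by (metis mult.assoc)
      qed
      also have "max y t - min y t = \<bar>y - t\<bar>" by simp
      also have "e / 2 * \<bar>y - t\<bar> < e * \<bar>y - t\<bar>" using \<open>e > 0\<close> y by simp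
      finally have "\<bar>W y - W t\<bar> < e * \<bar>y - t\<bar>" by (auto simp: max_def min_def split: if_splits)
      then show ?thesis using y by (simp add: field_simps)
    qed
    then show "\<forall>\<^sub>F y in at t within {0..T}. dist ((W y - W t) / (y - t)) 0 < e"
      unfolding eventually_at using d(1) by (intro exI[of _ d]) (auto simp: dist_real_def)
  qed
  then have "\<exists>c. \<forall>t\<in>{0..T}. W t = c"
    by (intro has_field_derivative_zero_constant) auto
  then have "W T = W 0" using T by auto
  then show ?thesis by (simp add: W_def k_def x_0)
qed

section \<open>Fubini and two-sided bounds for J\<close>

definition J where "J T s = (\<integral>t. ratio T s t \<partial>lborel)"

lemma J_integrable: "integrable \<mu> (J T)"
  using integrable_fst[OF ratio_integrable[of T]] by (simp add: J_def[abs_def])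

lemma F_int_x_eq:
  assumes "0 \<le> T"
  shows "F_int f (x T) = F_int f \<psi> + (\<integral>s. J T s \<partial>\<mu>)"
proof -
  have "F_int f (x T) - F_int f \<psi> = (\<integral>t. (\<integral>s. ratio T s t \<partial>\<mu>) \<partial>lborel)"
    unfolding F_int_x_eq_integral[OF assms] rate_over_g_eq[symmetric]
    using set_borel_integral_eq_integral(2)[OF rate_over_g_set_integrable[of T]]
    by (simp add: set_lebesgue_integral_def)
  also have "\<dots> = (\<integral>s. J T s \<partial>\<mu>)"
    unfolding J_def by (rule Fubini_integral[OF ratio_integrable])
  finally show ?thesis by simp
qed

definition L where "L t = ln (g t)"

lemma L_cont: "continuous_on A L"
  unfolding L_def by (intro continuous_intros g_cont) simp

text \<open>\<open>L\<close> is continuous on the whole line because \<open>g\<close> is extended to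
  negative times, so one primitive serves all shifts \<open>t - s\<close>.\<close>

lemma L_primitive:
  obtains \<Lambda> where "\<And>t. (\<Lambda> has_real_derivative L t) (at t)"
proof -
  have "\<exists>F. \<forall>t::real. -\<infinity> < ereal t \<longrightarrow> ereal t < \<infinity> \<longrightarrow> (F has_vector_derivative L t) (at t)"
    using L_cont[of UNIV] by (intro einterval_antiderivative) (auto simp: continuous_on_eq_continuous_at)
  then show ?thesis using that by (auto simp: has_real_derivative_iff_has_vector_derivative)
qed

lemma L_quasi_mono: "s \<le> t \<Longrightarrow> L s \<le> L t + ln B"
proof -
  assume "s \<le> t"
  then have "ln (g s) \<le> ln (B * g t)"
    using g_quasi_mono[of s t] g_pos[of s] by (intro ln_mono) auto
  also have "\<dots> = ln B + ln (g t)"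
    using g_pos[of t] B(1) by (simp add: ln_mult)
  finally show "L s \<le> L t + ln B" by (simp add: L_def)
qed

lemma ln_B_nonneg: "ln B \<ge> 0"
  using B(1) by simp

lemma ratio_eq_exp: "g (t - s) / g t = exp (- (L t - L (t - s)))"
  using g_pos by (simp add: L_def exp_diff)

lemma g_quotient_set_integrable: "set_integrable lborel {s..T} (\<lambda>t. g (t - s) / g t)"
  by (intro borel_integrable_atLeastAtMost' continuous_intros g_cont
      continuous_on_compose2[OF g_cont[of UNIV]]) auto

lemma J_has_integral:
  assumes "0 \<le> s"
  shows "((\<lambda>t. g (t - s) / g t) has_integral J T s) {s..T}"
proof -
  have "J T s = (LINT t:{s..T}|lborel. g (t - s) / g t)"
    unfolding J_def ratio_def set_lebesgue_integral_def
    using assms by (intro Bochner_Integration.integral_cong) (auto simp: indicator_def)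
  then show ?thesis
    using set_borel_integral_eq_integral[OF g_quotient_set_integrable] by (metis integrable_integral)
qed

lemma J_nonneg: "0 \<le> J T s"
  unfolding J_def by (intro Bochner_Integration.integral_nonneg ratio_nonneg)

text \<open>Integrate \<open>1 - u \<le> exp (- u)\<close> with \<open>u = L t - L (t - s)\<close>
  over \<open>[s, T]\<close>. Telescoping leaves the increments of a primitive of \<open>L\<close>
  over \<open>[T - s, T]\<close> and \<open>[0, s]\<close>; quasi-monotonicity replaces them by
  \<open>s * L T\<close> and \<open>s * L 0\<close> at a cost of \<open>s * ln B\<close>
  each.\<close>

lemma J_lower:
  assumes "0 \<le> s" "0 \<le> T"
  shows "T - s * (1 + L T - L 0 + 2 * ln B) \<le> J T s"
proof (cases "s \<le> T")
  case True
  obtain \<Lambda> where \<Lambda>: "\<And>t. (\<Lambda> has_real_derivative L t) (at t)" using L_primitive by blast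
  define H where "H t = t - (\<Lambda> t - \<Lambda> (t - s))" for t
  have "((\<lambda>t. 1 - (L t - L (t - s))) has_integral H T - H s) {s..T}"
    unfolding H_def
    by (rule fundamental_theorem_of_calculus[OF True])
       (auto intro!: derivative_eq_intros DERIV_chain2[OF \<Lambda>] has_field_derivative_at_within[OF \<Lambda>]
          simp flip: has_real_derivative_iff_has_vector_derivative)
  moreover have "1 - (L t - L (t - s)) \<le> g (t - s) / g t" for t
    unfolding ratio_eq_exp using exp_ge_add_one_self[of "- (L t - L (t - s))"] by linarith
  ultimately have "H T - H s \<le> J T s"
    using J_has_integral[OF assms(1), of T] has_integral_le by blast
  moreover have "\<Lambda> T - \<Lambda> (T - s) \<le> s * (L T + ln B)"
    by (rule primitive_increment_bounds(2)[OF \<Lambda> assms(1), where lo = "L (T - s) - ln B"])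
       (use L_quasi_mono in \<open>force\<close>)
  moreover have "s * (L 0 - ln B) \<le> \<Lambda> s - \<Lambda> (s - s)"
    by (rule primitive_increment_bounds(1)[OF \<Lambda> assms(1), where hi = "L s + ln B"])
       (use L_quasi_mono in \<open>force\<close>)
  ultimately show ?thesis by (simp add: H_def algebra_simps)
next
  \<comment> \<open>For \<open>s > T\<close> the left side is negative, because the factor of
    \<open>s\<close> is at least 1.\<close>
  case False
  have "s * 1 \<le> s * (1 + L T - L 0 + 2 * ln B)"
    using L_quasi_mono[of 0 T] ln_B_nonneg assms by (intro mult_left_mono) auto
  then show ?thesis using J_nonneg[of T s] False by linarith
qed

text \<open>Once the delayed time \<open>t - s\<close> exceeds \<open>T\<^sub>0\<close>, f is
  increasing at the values involved and the kernel is at most 1. The earlier times form a window of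
  length \<open>T\<^sub>0\<close>, where \<open>B\<close> bounds it. The result is uniform in
  \<open>s\<close>.\<close>

lemma J_upper:
  assumes "0 \<le> s" "0 \<le> T" "0 \<le> T\<^sub>0" "x\<^sub>1 < x T\<^sub>0"
  shows "J T s \<le> T + B * T\<^sub>0"
proof -
  have i: "integrable lborel (\<lambda>t. ratio T s t)"
  proof -
    have "(\<lambda>t. indicator {s..T} t *\<^sub>R (g (t - s) / g t)) = (\<lambda>t. ratio T s t)"
      using assms by (auto simp: ratio_def indicator_def)
    then show ?thesis
      using g_quotient_set_integrable[of s T] by (simp only: set_integrable_def)
  qed
  have "J T s \<le> (\<integral>t. indicator {0..T} t + B * indicator {s..s + T\<^sub>0} t \<partial>lborel)"
    unfolding J_def
  proof (rule integral_mono[OF i])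
    show "integrable lborel (\<lambda>t. indicat_real {0..T} t + B * indicat_real {s..s + T\<^sub>0} t)"
      by (intro Bochner_Integration.integrable_add integrable_mult_right integrable_real_indicator)
         (auto simp: emeasure_lborel_Icc_eq)
    fix t :: real
    show "ratio T s t \<le> indicator {0..T} t + B * indicator {s..s + T\<^sub>0} t"
    proof (cases "t - s \<le> T\<^sub>0 \<or> t < s \<or> T < t")
      case True
      then show ?thesis using ratio_le_B[of s T t] B(1) assms
        by (auto simp: ratio_def indicator_def split: if_splits)
    next
      case False
      have "x T\<^sub>0 \<le> x (t - s)" "x (t - s) \<le> x t" using False assms by (auto intro!: x_mono)
      then have "g (t - s) \<le> g t"
        using False assms x_pos[of "t - s"] by (auto simp: g_nonneg_eq intro!: f_mono)
      then have "g (t - s) / g t \<le> 1" using g_pos[of t] by simp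
      then show ?thesis using False assms B(1) by (auto simp: ratio_def indicator_def)
    qed
  qed
  also have "\<dots> = T + B * T\<^sub>0"
    using assms by (subst Bochner_Integration.integral_add)
      (auto simp: emeasure_lborel_Icc_eq intro!: integrable_mult_right integrable_real_indicator)
  finally show ?thesis .
qed

section \<open>Linear growth of F(x(t))\<close>

lemma Icc_mu_sets: "{0..S} \<in> sets \<mu>"
  unfolding mu_sets sets_restrict_space by (auto intro!: image_eqI[of _ _ "{..S}"])

text \<open>Delays above \<open>S\<close> are dropped by \<open>J_nonneg\<close>, and among the
  others \<open>s = S\<close> gives the smallest bound. The estimate stays meaningful when the first
  moment of \<open>\<mu>\<close> is infinite.\<close>

lemma F_lower_truncated:
  assumes "0 \<le> T" "0 \<le> S"
  shows "F_int f \<psi> + measure \<mu> {0..S} * (T - S * (1 + L T - L 0 + 2 * ln B)) \<le> F_int f (x T)"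
proof -
  define P where "P = 1 + L T - L 0 + 2 * ln B"
  have P: "P \<ge> 1" using L_quasi_mono[of 0 T] ln_B_nonneg assms by (simp add: P_def)
  have "(\<integral>s. indicator {0..S} s * (T - S * P) \<partial>\<mu>) \<le> (\<integral>s. J T s \<partial>\<mu>)"
  proof (rule integral_mono[OF _ J_integrable])
    show "integrable \<mu> (\<lambda>s. indicator {0..S} s * (T - S * P))"
      using Icc_mu_sets by (intro integrable_mult_left integrable_real_indicator) (auto simp: less_top[symmetric])
    fix s assume "s \<in> space \<mu>"
    then have s: "s \<ge> 0" by (simp add: space_mu)
    show "indicator {0..S} s * (T - S * P) \<le> J T s"
    proof (cases "s \<le> S")
      case True
      then have "T - S * P \<le> T - s * P" using P by (simp add: mult_right_mono)
      also have "\<dots> \<le> J T s" unfolding P_def by (rule J_lower[OF s assms(1)])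
      finally show ?thesis using True s by simp
    qed (use J_nonneg in simp)
  qed
  then have "measure \<mu> {0..S} * (T - S * P) \<le> (\<integral>s. J T s \<partial>\<mu>)"
    using Icc_mu_sets sets.sets_into_space[OF Icc_mu_sets] by (simp add: Int_absorb2)
  then show ?thesis unfolding F_int_x_eq[OF assms(1)] P_def by simp
qed

text \<open>If F(x(T)) were at most \<open>b * T\<close>, then \<open>ln_f_le_F_int\<close> would
  make the correction \<open>m * S * L T\<close> in \<open>F_lower_truncated\<close> a small
  multiple of \<open>T\<close>. With \<open>S\<close> so large that the mass \<open>m\<close> of
  \<open>{0..S}\<close> exceeds \<open>q\<close>, this gives \<open>m * T \<le> r * T\<close> up to
  a constant, where \<open>r < q < m\<close>; that fails for large \<open>T\<close>.\<close>

lemma F_lower_linear: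
  assumes "a < M"
  shows "\<forall>\<^sub>F t in at_top. a * t < F_int f (x t)"
proof -
  \<comment> \<open>Raising \<open>a\<close> to a positive number below \<open>M\<close> permits the
    division by \<open>b\<close> in the choice of \<open>\<eta>\<close>.\<close>
  define b where "b = max a (M / 2)"
  define q where "q = (b + M) / 2"
  have bq: "0 < b" "b < q" "q < M" "a \<le> b"
    using assms M(2) by (auto simp: b_def q_def)
  have "(\<lambda>n. measure \<mu> {0..real n}) \<longlonglongrightarrow> measure \<mu> (\<Union>n. {0..real n})"
    using Icc_mu_sets by (intro mu.finite_Lim_measure_incseq) (auto simp: incseq_def)
  also have "(\<Union>n. {0..real n}) = {0..}"
    by (auto simp: real_arch_simple)
  finally have "(\<lambda>n. measure \<mu> {0..real n}) \<longlonglongrightarrow> M" by (simp flip: M(1))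
  then have "\<forall>\<^sub>F n in sequentially. q < measure \<mu> {0..real n}"
    using bq by (intro order_tendstoD)
  then have "\<forall>\<^sub>F n in sequentially. q < measure \<mu> {0..real n} \<and> n > 0"
    using eventually_gt_at_top by (rule eventually_conj)
  then obtain n where n: "q < measure \<mu> {0..real n}" "n > 0"
    by (auto dest: eventually_happens)
  define S where "S = real n"
  define m where "m = measure \<mu> {0..S}"
  have S: "S > 0" "q < m" using n by (auto simp: S_def m_def)
  \<comment> \<open>\<open>\<eta>\<close> will solve \<open>b * (1 + m * S * \<eta>) = r\<close>,
    the total slope under the assumption to be refuted.\<close>
  define r where "r = (b + q) / 2"
  define \<eta> where "\<eta> = (r / b - 1) / (m * S)"
  have mS: "m * S > 0" using bq S by simp
  have "r / b > 1" using bq by (simp add: r_def)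
  then have \<eta>: "\<eta> > 0" unfolding \<eta>_def using mS by (intro divide_pos_pos) auto
  have "m * S * \<eta> = r / b - 1" using bq S by (simp add: \<eta>_def)
  then have r: "r = b * (1 + m * S * \<eta>)" using bq by simp
  have r': "r < q" using bq by (simp add: r_def)
  obtain c where c: "\<And>y. \<psi> \<le> y \<Longrightarrow> ln (f y) \<le> \<eta> * F_int f y + c"
    using ln_f_le_F_int[OF \<eta> psi] by blast
  define c' where "c' = F_int f \<psi> - m * S * (1 + c - L 0 + 2 * ln B)"
  have *: "b * T < F_int f (x T)" if T: "T \<ge> 0" "T > - c' / (q - r)" for T
  proof (rule ccontr)
    assume "\<not> b * T < F_int f (x T)"
    then have F: "F_int f (x T) \<le> b * T" by simp
    have "L T \<le> \<eta> * F_int f (x T) + c"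
      using c[OF x_ge_psi[OF T(1)]] T by (simp add: L_def g_nonneg_eq)
    also have "\<dots> \<le> \<eta> * (b * T) + c" using F \<eta> by simp
    finally have "m * S * L T \<le> m * S * (\<eta> * (b * T) + c)"
      using mS by (intro mult_left_mono) auto
    then have "m * T + c' \<le> b * T + m * S * \<eta> * (b * T)"
      using F_lower_truncated[OF T(1), of S] F S by (simp add: m_def c'_def algebra_simps)
    also have "\<dots> = r * T" using arg_cong[OF r, of "\<lambda>z. z * T"] by (simp add: algebra_simps)
    finally have "q * T + c' \<le> r * T" using S T mult_right_mono[of q m T] by linarith
    then show False using T(2) r' by (simp add: field_simps)
  qed
  have "\<forall>\<^sub>F t in at_top. b * t < F_int f (x t)"
    using eventually_ge_at_top[of 0] eventually_gt_at_top[of "- c' / (q - r)"]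
    by eventually_elim (rule *)
  then show ?thesis
    using eventually_ge_at_top[of 0]
  proof eventually_elim
    case (elim t)
    then show ?case using mult_right_mono[of a b t] bq by linarith
  qed
qed

lemma F_int_x_at_top: "filterlim (\<lambda>t. F_int f (x t)) at_top at_top"
proof (rule filterlim_at_top_mono)
  show "filterlim (\<lambda>t. M / 2 * t) at_top at_top"
    using M(2) by (intro filterlim_tendsto_pos_mult_at_top[OF tendsto_const _ filterlim_ident]) auto
  show "\<forall>\<^sub>F t in at_top. M / 2 * t \<le> F_int f (x t)"
    using F_lower_linear[of "M / 2"] M(2) by (auto elim: eventually_mono)
qed

lemma at_top_of_F_int_at_top:
  assumes "filterlim (\<lambda>t. F_int f (y t)) at_top F" "\<forall>\<^sub>F t in F. y t > 0"
  shows "filterlim y at_top F"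
  unfolding filterlim_at_top_gt[where c = 0]
proof (intro allI impI)
  fix Z :: real assume Z: "Z > 0"
  have "\<forall>\<^sub>F t in F. F_int f (y t) \<ge> F_int f Z"
    using assms(1) by (simp add: filterlim_at_top)
  with assms(2) show "\<forall>\<^sub>F t in F. Z \<le> y t"
    by eventually_elim (use Z F_int_le_iff in blast)
qed

lemma x_at_top: "filterlim x at_top at_top"
  by (rule at_top_of_F_int_at_top[OF F_int_x_at_top])
     (auto intro!: eventually_mono[OF eventually_ge_at_top[of 0]] x_pos)

lemma x_exceeds:
  obtains t where "t \<ge> 0" "x t > y"
proof -
  have "\<forall>\<^sub>F t in at_top. x t > y \<and> t \<ge> 0"
    using x_at_top eventually_ge_at_top[of 0] by (auto simp: filterlim_at_top_dense eventually_conj_iff)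
  then show ?thesis using that by (auto dest: eventually_happens)
qed

lemma integral_J_le:
  assumes "\<And>s. 0 \<le> s \<Longrightarrow> J T s \<le> a"
  shows "(\<integral>s. J T s \<partial>\<mu>) \<le> M * a"
proof -
  have "(\<integral>s. J T s \<partial>\<mu>) \<le> (\<integral>s. a \<partial>\<mu>)"
    using assms by (intro integral_mono[OF J_integrable]) (auto simp: space_mu)
  then show ?thesis by (simp only: integral_mu_const)
qed

lemma F_upper:
  obtains c where "\<And>T. 0 \<le> T \<Longrightarrow> F_int f (x T) \<le> M * T + c"
proof -
  obtain T\<^sub>0 where T0: "T\<^sub>0 \<ge> 0" "x T\<^sub>0 > x\<^sub>1" by (rule x_exceeds)
  have "F_int f (x T) \<le> M * T + (F_int f \<psi> + M * (B * T\<^sub>0))" if "0 \<le> T" for T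
    using integral_J_le[OF J_upper[OF _ that T0]] F_int_x_eq[OF that] by (simp add: algebra_simps)
  then show ?thesis by (rule that)
qed

lemma F_int_x_over_t: "((\<lambda>t. F_int f (x t) / t) \<longlongrightarrow> M) at_top"
proof (rule order_tendstoI)
  fix a assume "a < M"
  from F_lower_linear[OF this] eventually_gt_at_top[of 0]
  show "\<forall>\<^sub>F t in at_top. a < F_int f (x t) / t"
    by eventually_elim (simp add: field_simps)
next
  fix a assume a: "M < a"
  obtain c where c: "\<And>T. 0 \<le> T \<Longrightarrow> F_int f (x T) \<le> M * T + c" by (rule F_upper) blast
  show "\<forall>\<^sub>F t in at_top. F_int f (x t) / t < a"
    using eventually_gt_at_top[of 0] eventually_gt_at_top[of "c / (a - M)"]
  proof eventually_elim
    case (elim t)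
    then have "M * t + c < a * t" using a by (simp add: field_simps)
    then show ?case using c[of t] elim by (simp add: field_simps)
  qed
qed

section \<open>Refined bounds and the asymptotic ratio\<close>

lemma F_int_x_lipschitz:
  assumes "0 \<le> a" "a \<le> b"
  shows "F_int f (x b) - F_int f (x a) \<le> M * B * (b - a)"
proof -
  have "integral {0..a} (\<lambda>t. rate t / g t) + integral {a..b} (\<lambda>t. rate t / g t) = integral {0..b} (\<lambda>t. rate t / g t)"
    using assms by (intro Henstock_Kurzweil_Integration.integral_combine rate_over_g_integrable) auto
  then have "F_int f (x b) - F_int f (x a) = integral {a..b} (\<lambda>t. rate t / g t)"
    using F_int_x_eq_integral[of a] F_int_x_eq_integral[of b] assms by simp
  also have "\<dots> \<le> integral {a..b} (\<lambda>t. M * B)"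
  proof (rule integral_le)
    show "rate t / g t \<le> M * B" if "t \<in> {a..b}" for t
      using rate_le[of t] g_pos[of t] that assms by (simp add: field_simps)
  qed (use assms rate_over_g_integrable in auto)
  finally show ?thesis using assms by (simp add: mult_ac)
qed

text \<open>Far out, \<open>ln f\<close> grows at most \<open>\<eta>\<close> times as much as F, and
  F(x(t)) is Lipschitz with constant \<open>M * B\<close>; over a delay of at most \<open>S\<close>
  the change is at most \<open>\<eta> * (M * B * S)\<close>. The sign comes from the monotonicity of
  f beyond \<open>x\<^sub>1\<close>.\<close>

lemma L_increment_small:
  assumes "\<delta> > 0" "S \<ge> 0"
  obtains T where "T \<ge> S" "\<And>s t. 0 \<le> s \<Longrightarrow> s \<le> S \<Longrightarrow> T \<le> t \<Longrightarrow> 0 \<le> L t - L (t - s) \<and> L t - L (t - s) \<le> \<delta>"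
proof -
  \<comment> \<open>The summand 1 keeps the denominator positive when \<open>S = 0\<close>.\<close>
  define \<eta> where "\<eta> = \<delta> / (M * B * S + 1)"
  have MBS: "M * B * S \<ge> 0" using M(2) B(1) assms by simp
  have \<eta>: "\<eta> > 0" "\<eta> * (M * B * S) \<le> \<delta>"
    using MBS assms unfolding \<eta>_def by (auto simp: field_simps)
  obtain Y where Y: "Y > 0" "\<And>a b. Y \<le> a \<Longrightarrow> a \<le> b \<Longrightarrow> ln (f b) - ln (f a) \<le> \<eta> * (F_int f b - F_int f a)"
    using ln_f_increment[OF \<eta>(1)] by metis
  obtain T\<^sub>0 where T0: "T\<^sub>0 \<ge> 0" "x T\<^sub>0 > max Y x\<^sub>1" by (rule x_exceeds)
  show ?thesis
  proof (rule that[of "T\<^sub>0 + S"])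
    fix s t assume st: "0 \<le> s" "s \<le> S" "T\<^sub>0 + S \<le> t"
    have xs: "x T\<^sub>0 \<le> x (t - s)" "x (t - s) \<le> x t" using st T0 by (auto intro!: x_mono)
    have pos: "x (t - s) > 0" using st T0 by (intro x_pos) auto
    have L: "L t = ln (f (x t))" "L (t - s) = ln (f (x (t - s)))"
      using st T0 by (auto simp: L_def g_nonneg_eq)
    have "f (x (t - s)) \<le> f (x t)"
      using xs pos T0 by (intro f_mono) auto
    then have "L (t - s) \<le> L t" unfolding L using f_pos[OF pos] by (intro ln_mono) auto
    moreover have "L t - L (t - s) \<le> \<eta> * (F_int f (x t) - F_int f (x (t - s)))"
      unfolding L using xs T0 by (intro Y) auto
    moreover have "F_int f (x t) - F_int f (x (t - s)) \<le> M * B * s"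
      using F_int_x_lipschitz[of "t - s" t] st T0 by simp
    moreover have "M * B * s \<le> M * B * S" using st M(2) B(1) by (intro mult_left_mono) auto
    ultimately show "0 \<le> L t - L (t - s) \<and> L t - L (t - s) \<le> \<delta>"
      using \<eta> mult_left_mono[of "F_int f (x t) - F_int f (x (t - s))" "M * B * S" \<eta>] by linarith
  qed (use T0 in simp)
qed

text \<open>Up to \<open>T\<^sub>1\<close> the kernel is bounded by \<open>B\<close>, which costs a
  constant. After \<open>T\<^sub>1\<close> the exponent \<open>u = L t - L (t - s)\<close> lies in
  \<open>[0, \<delta>]\<close>, so \<open>exp_minus_le_linear\<close> applies, and the integral of
  \<open>u\<close> telescopes to \<open>s * L T\<close> up to an error that \<open>c\<close> absorbs
  for all \<open>s \<le> S\<close>.\<close>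

lemma J_upper_refined:
  assumes "0 < \<delta>" "\<delta> < 1" "S \<ge> 0"
  obtains c T\<^sub>1 where "\<And>s T. 0 \<le> s \<Longrightarrow> s \<le> S \<Longrightarrow> T\<^sub>1 \<le> T \<Longrightarrow> J T s \<le> T + c - (1 - \<delta>) * s * L T"
proof -
  obtain \<Lambda> where \<Lambda>: "\<And>t. (\<Lambda> has_real_derivative L t) (at t)" using L_primitive by blast
  obtain T\<^sub>1 where T1: "T\<^sub>1 \<ge> S"
    "\<And>s t. 0 \<le> s \<Longrightarrow> s \<le> S \<Longrightarrow> T\<^sub>1 \<le> t \<Longrightarrow> 0 \<le> L t - L (t - s) \<and> L t - L (t - s) \<le> \<delta>"
    using L_increment_small[OF assms(1,3)] by metis
  \<comment> \<open>The first term pays for the segment before \<open>T\<^sub>1\<close>, the second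
    for the boundary term at \<open>T\<^sub>1\<close> and the variation \<open>\<delta>\<close> of
    \<open>L\<close> near \<open>T\<close>. The absolute value allows \<open>s\<close> to be
    replaced by \<open>S\<close> whatever the sign.\<close>
  define c where "c = B * T\<^sub>1 + S * \<bar>L T\<^sub>1 + ln B + \<delta>\<bar>"
  have "J T s \<le> T + c - (1 - \<delta>) * s * L T" if s: "0 \<le> s" "s \<le> S" and T: "T\<^sub>1 \<le> T" for s T
  proof -
    define h where "h t = g (t - s) / g t" for t
    define H where "H t = t - (1 - \<delta>) * (\<Lambda> t - \<Lambda> (t - s))" for t
    have h: "(h has_integral J T s) {s..T}" unfolding h_def by (rule J_has_integral[OF s(1)])
    then have i: "h integrable_on {s..T}" by blast
    have "integral {s..T} h = integral {s..T\<^sub>1} h + integral {T\<^sub>1..T} h"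
      using s T T1 i by (intro Henstock_Kurzweil_Integration.integral_combine[symmetric]) auto
    then have J: "J T s = integral {s..T\<^sub>1} h + integral {T\<^sub>1..T} h"
      using integral_unique[OF h] by simp
    have i1: "h integrable_on {s..T\<^sub>1}" and i2: "h integrable_on {T\<^sub>1..T}"
      using i s T T1 by (auto intro: integrable_subinterval_real)
    have "integral {s..T\<^sub>1} h \<le> integral {s..T\<^sub>1} (\<lambda>t. B)"
    proof (rule integral_le[OF i1])
      show "h t \<le> B" for t
        using g_quasi_mono[of "t - s" t] s g_pos[of t] by (simp add: h_def field_simps)
    qed auto
    also have "\<dots> = B * (T\<^sub>1 - s)" using s T1 by simp
    also have "\<dots> \<le> B * T\<^sub>1" using s B by (intro mult_left_mono) auto
    finally have 1: "integral {s..T\<^sub>1} h \<le> B * T\<^sub>1" .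
    have "((\<lambda>t. 1 - (1 - \<delta>) * (L t - L (t - s))) has_integral H T - H T\<^sub>1) {T\<^sub>1..T}"
      unfolding H_def
      by (rule fundamental_theorem_of_calculus[OF T])
         (auto intro!: derivative_eq_intros DERIV_chain2[OF \<Lambda>] has_field_derivative_at_within[OF \<Lambda>]
            simp flip: has_real_derivative_iff_has_vector_derivative)
    moreover have "h t \<le> 1 - (1 - \<delta>) * (L t - L (t - s))" if "t \<in> {T\<^sub>1..T}" for t
      unfolding h_def ratio_eq_exp using T1(2)[of s t] s that by (intro exp_minus_le_linear) auto
    ultimately have 2: "integral {T\<^sub>1..T} h \<le> H T - H T\<^sub>1"
      using integrable_integral[OF i2] has_integral_le by blast
    have 3: "s * (L T - \<delta>) \<le> \<Lambda> T - \<Lambda> (T - s)"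
    proof (rule primitive_increment_bounds(1)[OF \<Lambda> s(1), where hi = "L T + ln B"])
      fix u assume "T - s \<le> u" "u \<le> T"
      then show "L T - \<delta> \<le> L u \<and> L u \<le> L T + ln B"
        using T1(2)[of "T - u" T] s T L_quasi_mono[of u T] by auto
    qed
    have 4: "\<Lambda> T\<^sub>1 - \<Lambda> (T\<^sub>1 - s) \<le> s * (L T\<^sub>1 + ln B)"
      by (rule primitive_increment_bounds(2)[OF \<Lambda> s(1), where lo = "L (T\<^sub>1 - s) - ln B"])
         (use L_quasi_mono in \<open>force\<close>)
    have "(1 - \<delta>) * ((\<Lambda> T\<^sub>1 - \<Lambda> (T\<^sub>1 - s)) - (\<Lambda> T - \<Lambda> (T - s)))
      \<le> (1 - \<delta>) * (s * (L T\<^sub>1 + ln B + \<delta>) - s * L T)"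
      using 3 4 assms by (intro mult_left_mono) (auto simp: algebra_simps)
    moreover have "(1 - \<delta>) * (s * (L T\<^sub>1 + ln B + \<delta>)) \<le> 1 * (S * \<bar>L T\<^sub>1 + ln B + \<delta>\<bar>)"
    proof -
      have "(1 - \<delta>) * (s * (L T\<^sub>1 + ln B + \<delta>)) \<le> (1 - \<delta>) * (s * \<bar>L T\<^sub>1 + ln B + \<delta>\<bar>)"
        using assms s by (intro mult_left_mono) auto
      also have "\<dots> \<le> 1 * (S * \<bar>L T\<^sub>1 + ln B + \<delta>\<bar>)"
        using assms s by (intro mult_mono) auto
      finally show ?thesis .
    qed
    ultimately have "H T - H T\<^sub>1 \<le> T - T\<^sub>1 + S * \<bar>L T\<^sub>1 + ln B + \<delta>\<bar> - (1 - \<delta>) * s * L T"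
      by (simp add: H_def algebra_simps)
    then show ?thesis using J 1 2 T1(1) assms(3) by (simp add: c_def)
  qed
  then show ?thesis by (rule that)
qed

text \<open>Finite for every \<open>S\<close>, also when the first moment of \<open>\<mu>\<close>
  diverges, and tending to that moment as \<open>S\<close> grows.\<close>

definition truncated_moment where
  "truncated_moment S = (\<integral>s. indicator {0..S} s * s \<partial>\<mu>)"

lemma truncated_moment_integrable: "integrable \<mu> (\<lambda>s. indicator {0..S} s * s)"
proof (rule mu.integrable_const_bound[where B = "\<bar>S\<bar>"])
  have [measurable]: "(\<lambda>s. s) \<in> borel_measurable \<mu>" by (rule ident_mu_measurable)
  show "(\<lambda>s. indicator {0..S} s * s) \<in> borel_measurable \<mu>" by measurable
qed (auto simp: indicator_def)

text \<open>Delays up to \<open>S\<close> use \<open>J_upper_refined\<close>, longer ones the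
  uniform bound \<open>J_upper\<close>; only the former contribute a multiple of
  \<open>L T\<close>.\<close>

lemma F_upper_refined:
  assumes "0 < \<delta>" "\<delta> < 1" "S \<ge> 0"
  obtains c where "\<forall>\<^sub>F T in at_top. F_int f (x T) \<le> M * T + c - (1 - \<delta>) * truncated_moment S * L T"
proof -
  obtain c T\<^sub>1 where c: "\<And>s T. 0 \<le> s \<Longrightarrow> s \<le> S \<Longrightarrow> T\<^sub>1 \<le> T \<Longrightarrow> J T s \<le> T + c - (1 - \<delta>) * s * L T"
    using J_upper_refined[OF assms] by metis
  obtain T\<^sub>0 where T0: "T\<^sub>0 \<ge> 0" "x T\<^sub>0 > x\<^sub>1" by (rule x_exceeds)
  define c' where "c' = max c (B * T\<^sub>0)"
  have *: "F_int f (x T) \<le> M * T + (F_int f \<psi> + M * c') - (1 - \<delta>) * truncated_moment S * L T"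
    if T: "T \<ge> T\<^sub>1" "T \<ge> 0" for T
  proof -
    have I: "integrable \<mu> (\<lambda>s. (1 - \<delta>) * L T * (indicator {0..S} s * s))"
      by (intro integrable_mult_right truncated_moment_integrable)
    have "(\<integral>s. J T s \<partial>\<mu>) \<le> (\<integral>s. (T + c') - (1 - \<delta>) * L T * (indicator {0..S} s * s) \<partial>\<mu>)"
    proof (rule integral_mono[OF J_integrable])
      show "integrable \<mu> (\<lambda>s. (T + c') - (1 - \<delta>) * L T * (indicator {0..S} s * s))"
        by (intro Bochner_Integration.integrable_diff I) auto
      fix s assume "s \<in> space \<mu>"
      then have s: "s \<ge> 0" by (simp add: space_mu)
      show "J T s \<le> (T + c') - (1 - \<delta>) * L T * (indicator {0..S} s * s)"
      proof (cases "s \<le> S")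
        case True
        then show ?thesis using c[OF s True T(1)] s by (simp add: c'_def algebra_simps)
      next
        case False
        then show ?thesis using J_upper[OF s T(2) T0] by (simp add: c'_def)
      qed
    qed
    also have "\<dots> = (\<integral>s. T + c' \<partial>\<mu>) - (1 - \<delta>) * L T * truncated_moment S"
      unfolding truncated_moment_def
      by (subst Bochner_Integration.integral_diff[OF _ I]) (auto simp del: integral_const)
    also have "(\<integral>s. T + c' \<partial>\<mu>) = M * (T + c')" by (rule integral_mu_const)
    finally show ?thesis using F_int_x_eq[OF T(2)] by (simp add: algebra_simps)
  qed
  have "\<forall>\<^sub>F T in at_top. F_int f (x T) \<le> M * T + (F_int f \<psi> + M * c') - (1 - \<delta>) * truncated_moment S * L T"
    using eventually_ge_at_top[of 0] eventually_ge_at_top[of T\<^sub>1] by eventually_elim (rule *)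
  then show ?thesis by (rule that)
qed

lemma F_lower:
  assumes "integrable \<mu> (\<lambda>s. s)"
  obtains c where "\<And>T. 0 \<le> T \<Longrightarrow> M * T - (\<integral>s. s \<partial>\<mu>) * L T - c \<le> F_int f (x T)"
proof -
  define c where "c = (\<integral>s. s \<partial>\<mu>) * (1 - L 0 + 2 * ln B) - F_int f \<psi>"
  have "M * T - (\<integral>s. s \<partial>\<mu>) * L T - c \<le> F_int f (x T)" if T: "0 \<le> T" for T
  proof -
    define P where "P = 1 + L T - L 0 + 2 * ln B"
    have I: "integrable \<mu> (\<lambda>s. s * P)" using assms by (rule integrable_mult_left)
    have "(\<integral>s. T - s * P \<partial>\<mu>) \<le> (\<integral>s. J T s \<partial>\<mu>)"
    proof (rule integral_mono[OF _ J_integrable])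
      show "integrable \<mu> (\<lambda>s. T - s * P)"
        using I by (intro Bochner_Integration.integrable_diff) auto
      show "T - s * P \<le> J T s" if "s \<in> space \<mu>" for s
        unfolding P_def using that T by (intro J_lower) (auto simp: space_mu)
    qed
    moreover have "(\<integral>s. T - s * P \<partial>\<mu>) = (\<integral>s. T \<partial>\<mu>) - (\<integral>s. s \<partial>\<mu>) * P"
      by (subst Bochner_Integration.integral_diff[OF _ I]) (auto simp del: integral_const)
    moreover have "(\<integral>s. T \<partial>\<mu>) = M * T" by (rule integral_mu_const)
    ultimately have "M * T - (\<integral>s. s \<partial>\<mu>) * P \<le> F_int f (x T) - F_int f \<psi>"
      unfolding F_int_x_eq[OF T] by linarith
    then show ?thesis by (simp add: c_def P_def algebra_simps)
  qed
  then show ?thesis by (rule that)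
qed

section \<open>The deficit M t - F(x(t)) measured against ln x(t)\<close>

lemma ln_x_at_top: "filterlim (\<lambda>t. ln (x t)) at_top at_top"
  using ln_at_top x_at_top by (rule filterlim_compose)

text \<open>Monotone convergence: the truncated integrands increase to \<open>s\<close>, so their
  integrals pass every level below the full moment, finite or not.\<close>

lemma truncated_moment_exceeds:
  assumes "ennreal \<kappa> < (\<integral>\<^sup>+ s. ennreal s \<partial>\<mu>)" "\<kappa> \<ge> 0"
  obtains S where "S \<ge> 0" "\<kappa> < truncated_moment S"
proof -
  have [measurable]: "(\<lambda>s. s) \<in> borel_measurable \<mu>" by (rule ident_mu_measurable)
  have nn: "(\<integral>\<^sup>+ s. ennreal (indicator {0..S} s * s) \<partial>\<mu>) = ennreal (truncated_moment S)" for S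
    unfolding truncated_moment_def
    by (intro nn_integral_eq_integral truncated_moment_integrable) (auto simp: indicator_def)
  have "(\<integral>\<^sup>+ s. ennreal s \<partial>\<mu>) = (\<integral>\<^sup>+ s. (SUP n. ennreal (indicator {0..real n} s * s)) \<partial>\<mu>)"
  proof (rule nn_integral_cong)
    fix s assume "s \<in> space \<mu>"
    then have s: "s \<ge> 0" by (simp add: space_mu)
    show "ennreal s = (SUP n. ennreal (indicator {0..real n} s * s))"
    proof (rule antisym)
      obtain n where "s \<le> real n" using real_arch_simple by blast
      then show "ennreal s \<le> (SUP n. ennreal (indicator {0..real n} s * s))"
        using s by (intro SUP_upper2[of n]) auto
    qed (use s in \<open>auto intro!: SUP_least ennreal_leI simp: indicator_def\<close>)
  qed
  also have "\<dots> = (SUP n. \<integral>\<^sup>+ s. ennreal (indicator {0..real n} s * s) \<partial>\<mu>)"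
    by (intro nn_integral_monotone_convergence_SUP)
       (auto simp: incseq_def le_fun_def indicator_def intro!: ennreal_leI)
  finally have "ennreal \<kappa> < (SUP n. ennreal (truncated_moment (real n)))"
    using assms(1) by (simp add: nn)
  then obtain n where "ennreal \<kappa> < ennreal (truncated_moment (real n))"
    by (auto simp: less_SUP_iff)
  then show ?thesis using that[of "real n"] assms(2) by (simp add: ennreal_less_iff)
qed

text \<open>\<open>F_upper_refined\<close> gives a deficit of about \<open>m * L t\<close>, and the
  lower bound on f makes \<open>L t\<close> nearly as large as \<open>ln (x t)\<close>. The losses
  are two factors \<open>1 - \<delta>\<close> and a constant, covered by the gap between
  \<open>\<kappa>\<close> and the truncated moment \<open>m\<close>.\<close>

lemma deficit_lower:
  assumes l: "l > 0" "\<forall>\<^sub>F u in at_top. l * u / ln u \<le> f u"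
    and \<kappa>: "\<kappa> > 0" "ennreal \<kappa> < (\<integral>\<^sup>+ s. ennreal s \<partial>\<mu>)"
  shows "\<forall>\<^sub>F t in at_top. \<kappa> * ln (x t) \<le> M * t - F_int f (x t)"
proof -
  obtain S where S: "S \<ge> 0" "\<kappa> < truncated_moment S"
    using truncated_moment_exceeds \<kappa> by (metis less_imp_le)
  define m where "m = truncated_moment S"
  have m: "0 < m" "\<kappa> < m" using S \<kappa> by (auto simp: m_def)
  define r where "r = \<kappa> / m"
  \<comment> \<open>Now \<open>\<kappa> = m * (1 - 3 * \<delta>)\<close>, while two factors
    \<open>1 - \<delta>\<close> lose less than \<open>3 * \<delta>\<close>. The surplus
    \<open>e * ln (x t)\<close> then absorbs \<open>c\<close>.\<close>
  define \<delta> where "\<delta> = (1 - r) / 3"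
  have "0 < r" "r < 1" using m \<kappa> by (auto simp: r_def)
  then have \<delta>: "0 < \<delta>" "\<delta> < 1" by (auto simp: \<delta>_def)
  have gap: "\<kappa> < (1 - \<delta>) * m * (1 - \<delta>)"
  proof -
    have "1 - 3 * \<delta> = r" by (simp add: \<delta>_def diff_divide_distrib)
    then have "\<kappa> = m * (1 - 3 * \<delta>)" using m by (simp add: r_def)
    also have "\<dots> < m * ((1 - \<delta>) * (1 - \<delta>))"
      using m \<delta> by (intro mult_strict_left_mono) (auto simp: algebra_simps intro: add_pos_nonneg)
    finally show ?thesis by (simp add: mult_ac)
  qed
  define e where "e = (1 - \<delta>) * m * (1 - \<delta>) - \<kappa>"
  have e: "e > 0" using gap by (simp add: e_def)
  obtain c where c: "\<forall>\<^sub>F T in at_top. F_int f (x T) \<le> M * T + c - (1 - \<delta>) * m * L T"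
    using F_upper_refined[OF \<delta> S(1)] unfolding m_def by metis
  have "\<forall>\<^sub>F u in at_top. (1 - \<delta>) * ln u \<le> ln (f u)"
    using \<delta> by (intro ln_f_lower[OF l(1) _ l(2)]) auto
  then have "\<forall>\<^sub>F t in at_top. (1 - \<delta>) * ln (x t) \<le> ln (f (x t))"
    using x_at_top by (rule eventually_compose_filterlim)
  moreover have "\<forall>\<^sub>F t in at_top. ln (x t) \<ge> c / e"
    using ln_x_at_top by (simp add: filterlim_at_top)
  ultimately show ?thesis using c eventually_ge_at_top[of 0]
  proof eventually_elim
    case (elim t)
    have "(1 - \<delta>) * m * ((1 - \<delta>) * ln (x t)) \<le> (1 - \<delta>) * m * L t"
      using elim m \<delta> by (intro mult_left_mono) (auto simp: L_def g_nonneg_eq)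
    moreover have "(1 - \<delta>) * m * ((1 - \<delta>) * ln (x t)) = \<kappa> * ln (x t) + e * ln (x t)"
      by (simp add: e_def algebra_simps)
    moreover have "c \<le> e * ln (x t)" using elim e by (simp add: field_simps)
    ultimately show ?case using elim by linarith
  qed
qed

text \<open>\<open>f u \<le> u\<close> bounds \<open>L t\<close> by \<open>ln (x t)\<close> in
  \<open>F_lower\<close>, and the surplus \<open>(\<kappa> - m) * ln (x t)\<close> absorbs the
  constant.\<close>

lemma deficit_upper:
  assumes f: "\<forall>\<^sub>F u in at_top. f u \<le> u"
    and C: "integrable \<mu> (\<lambda>s. s)" and \<kappa>: "(\<integral>s. s \<partial>\<mu>) < \<kappa>"
  shows "\<forall>\<^sub>F t in at_top. M * t - F_int f (x t) \<le> \<kappa> * ln (x t)"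
proof -
  define m where "m = (\<integral>s. s \<partial>\<mu>)"
  have m: "m \<ge> 0" "m < \<kappa>"
    using \<kappa> by (auto simp: m_def space_mu intro!: Bochner_Integration.integral_nonneg)
  obtain c where c: "\<And>T. 0 \<le> T \<Longrightarrow> M * T - m * L T - c \<le> F_int f (x T)"
    using F_lower[OF C] unfolding m_def by metis
  have "\<forall>\<^sub>F t in at_top. f (x t) \<le> x t"
    using f x_at_top by (rule eventually_compose_filterlim)
  moreover have "\<forall>\<^sub>F t in at_top. ln (x t) \<ge> c / (\<kappa> - m)"
    using ln_x_at_top by (simp add: filterlim_at_top)
  ultimately show ?thesis using eventually_ge_at_top[of 0]
  proof eventually_elim
    case (elim t)
    have "L t \<le> ln (x t)"
      using elim f_pos[OF x_pos[of t]] by (auto simp: L_def g_nonneg_eq intro!: ln_mono)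
    then have "m * L t \<le> m * ln (x t)" using m by (intro mult_left_mono)
    moreover have "c \<le> (\<kappa> - m) * ln (x t)" using elim m by (simp add: field_simps)
    then have "c \<le> \<kappa> * ln (x t) - m * ln (x t)" by (simp add: algebra_simps)
    ultimately show ?case using c[of t] elim by linarith
  qed
qed

section \<open>Comparison of the solution with the inverse of F at M t\<close>

definition z where "z t = F_inv f (M * t)"

text \<open>\<open>F_inv\<close> is meaningful only on the range of \<open>F_int f\<close>, so
  \<open>M * t\<close> must be shown to lie there. Along the solution \<open>F_int f\<close> becomes
  arbitrarily large, and the intermediate value theorem on \<open>[1, x s]\<close> starts from
  \<open>F_int f 1 = 0\<close>.\<close>

lemma z_props:
  assumes "t \<ge> 0"
  shows "z t > 0" "F_int f (z t) = M * t"
proof -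
  have "\<forall>\<^sub>F s in at_top. F_int f (x s) \<ge> M * t \<and> s \<ge> 0"
    using F_int_x_at_top by (auto simp: filterlim_at_top eventually_conj_iff eventually_ge_at_top)
  then obtain s where s: "F_int f (x s) \<ge> M * t" "s \<ge> 0"
    by (auto dest: eventually_happens)
  have Mt: "0 \<le> M * t" using assms M(2) by simp
  then have "F_int f 1 \<le> F_int f (x s)" using s F_int_1 by linarith
  then have xs: "1 \<le> x s" using F_int_le_iff[of 1 "x s"] x_pos[OF s(2)] by simp
  have "continuous_on {1..x s} (F_int f)"
    by (rule continuous_on_subset[OF F_int_cont]) auto
  then obtain y where "1 \<le> y" "F_int f y = M * t"
    using IVT'[of "F_int f" 1 "M * t" "x s"] s xs Mt F_int_1 by auto
  then have "M * t \<in> F_int f ` {0<..}" by (auto intro!: image_eqI[of _ _ y])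
  then show "z t > 0" "F_int f (z t) = M * t"
    unfolding z_def F_inv_def
    using the_inv_into_into[OF F_int_inj, of "M * t" "{0<..}"] f_the_inv_into_f[OF F_int_inj, of "M * t"]
    by auto
qed

lemma z_at_top: "filterlim z at_top at_top"
proof (rule at_top_of_F_int_at_top)
  have "filterlim (\<lambda>t. M * t) at_top at_top"
    using M(2) by (intro filterlim_tendsto_pos_mult_at_top[OF tendsto_const _ filterlim_ident]) auto
  then show "filterlim (\<lambda>t. F_int f (z t)) at_top at_top"
    by (rule filterlim_mono_eventually[OF _ order_refl order_refl])
       (auto intro!: eventually_mono[OF eventually_ge_at_top[of 0]] simp: z_props)
qed (auto intro!: eventually_mono[OF eventually_ge_at_top[of 0]] z_props)

text \<open>The deficit is F(z) - F(x), so \<open>F_int_diff_le_ln_squares\<close> turns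
  \<open>deficit_lower\<close> into a lower bound
  \<open>(ln x)\<^sup>2 + 2 * l * \<kappa> * ln x\<close> for \<open>(ln z)\<^sup>2\<close>. As
  \<open>a < l * \<kappa>\<close>, this exceeds \<open>(ln x + a)\<^sup>2\<close> for large
  \<open>ln x\<close>.\<close>

lemma ln_z_lower:
  assumes l: "l > 0" "\<forall>\<^sub>F u in at_top. l * u / ln u \<le> f u"
    and \<kappa>: "\<kappa> > 0" "ennreal \<kappa> < (\<integral>\<^sup>+ s. ennreal s \<partial>\<mu>)" and a: "0 \<le> a" "a < l * \<kappa>"
  shows "\<forall>\<^sub>F t in at_top. ln (x t) + a \<le> ln (z t)"
proof -
  obtain U where U: "\<And>u. U \<le> u \<Longrightarrow> l * u / ln u \<le> f u"
    using l(2) by (auto simp: eventually_at_top_linorder)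
  \<comment> \<open>Past the second threshold \<open>2 * (l * \<kappa> - a) * ln (x t)\<close>
    outgrows the term \<open>a\<^sup>2\<close> of the square.\<close>
  have "\<forall>\<^sub>F t in at_top. x t > max U 1" "\<forall>\<^sub>F t in at_top. ln (x t) > a\<^sup>2 / (2 * (l * \<kappa> - a))"
    using x_at_top ln_x_at_top by (simp_all only: filterlim_at_top_dense)
  with deficit_lower[OF l \<kappa>] show ?thesis using eventually_ge_at_top[of 0]
  proof eventually_elim
    case (elim t)
    have w: "ln (x t) > 0" using elim by simp
    have "0 \<le> \<kappa> * ln (x t)" using w \<kappa> by simp
    then have "F_int f (x t) \<le> F_int f (z t)"
      using elim z_props[of t] by simp
    then have xz: "x t \<le> z t" using elim F_int_le_iff[OF x_pos z_props(1), of t t] by simp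
    have "\<kappa> * ln (x t) \<le> ((ln (z t))\<^sup>2 - (ln (x t))\<^sup>2) / (2 * l)"
      using F_int_diff_le_ln_squares[OF l(1) _ xz] U elim z_props[of t] by fastforce
    then have "2 * l * \<kappa> * ln (x t) + (ln (x t))\<^sup>2 \<le> (ln (z t))\<^sup>2"
      using l by (simp add: field_simps)
    moreover have "a\<^sup>2 \<le> 2 * (l * \<kappa> - a) * ln (x t)"
      using elim a by (simp add: field_simps)
    ultimately have "(ln (x t) + a)\<^sup>2 \<le> (ln (z t))\<^sup>2"
      by (simp add: power2_eq_square algebra_simps)
    then show ?case
      by (rule power2_le_imp_le) (use xz elim in auto)
  qed
qed

text \<open>Completing the square only adds \<open>(l * \<kappa>)\<^sup>2\<close>, which is in the
  right direction here. The bound on f implies \<open>f u \<le> u\<close> once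
  \<open>ln u \<ge> l\<close>, as \<open>deficit_upper\<close> requires; where
  \<open>z t < x t\<close> the claim is immediate.\<close>

lemma ln_z_upper:
  assumes l: "l > 0" "\<forall>\<^sub>F u in at_top. f u \<le> l * u / ln u"
    and C: "integrable \<mu> (\<lambda>s. s)" and \<kappa>: "(\<integral>s. s \<partial>\<mu>) < \<kappa>"
  shows "\<forall>\<^sub>F t in at_top. ln (z t) \<le> ln (x t) + l * \<kappa>"
proof -
  obtain U where U: "\<And>u. U \<le> u \<Longrightarrow> f u \<le> l * u / ln u"
    using l(2) by (auto simp: eventually_at_top_linorder)
  have "\<kappa> > 0"
    using \<kappa> by (rule le_less_trans[rotated]) (auto simp: space_mu intro!: Bochner_Integration.integral_nonneg)
  have "\<forall>\<^sub>F u in at_top. ln u \<ge> l" using ln_at_top by (simp add: filterlim_at_top)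
  then have "\<forall>\<^sub>F u in at_top. f u \<le> u"
    using l(2) eventually_gt_at_top[of 0]
  proof eventually_elim
    case (elim u)
    have "l * u \<le> ln u * u" using elim by (intro mult_right_mono) auto
    moreover have "ln u > 0" using elim l(1) by linarith
    ultimately have "l * u / ln u \<le> u" by (simp add: field_simps)
    then show ?case using elim by simp
  qed
  note d = deficit_upper[OF this C \<kappa>]
  have "\<forall>\<^sub>F t in at_top. x t > max U 1"
    using x_at_top by (simp only: filterlim_at_top_dense)
  with d show ?thesis using eventually_ge_at_top[of 0]
  proof eventually_elim
    case (elim t)
    have w: "ln (x t) > 0" using elim by simp
    show ?case
    proof (cases "x t \<le> z t")
      case True
      have "((ln (z t))\<^sup>2 - (ln (x t))\<^sup>2) / (2 * l) \<le> \<kappa> * ln (x t)"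
        using F_int_diff_ge_ln_squares[OF l(1) _ True] U elim z_props[of t] by fastforce
      then have "(ln (z t))\<^sup>2 \<le> (ln (x t))\<^sup>2 + 2 * l * \<kappa> * ln (x t)"
        using l by (simp add: field_simps)
      also have "\<dots> \<le> (ln (x t) + l * \<kappa>)\<^sup>2"
        using zero_le_power2[of "l * \<kappa>"] by (simp add: power2_sum power_mult_distrib mult_ac)
      finally show ?thesis
        by (rule power2_le_imp_le) (use w l \<open>\<kappa> > 0\<close> in auto)
    next
      case False
      then have "ln (z t) \<le> ln (x t)" using z_props[of t] elim by simp
      then show ?thesis using l \<open>\<kappa> > 0\<close> by (simp add: add_increasing2)
    qed
  qed
qed

text \<open>Serves the limit \<lambda> = 0, where no positive \<open>l\<close> is available for
  \<open>ln_z_lower\<close>. By \<open>F_upper\<close>, F(x) - F(z) is at most \<open>c\<close>, so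
  where \<open>z t \<le> x t\<close> the squared logarithms differ by at most \<open>2 * c\<close>;
  dividing by \<open>ln (x t)\<close>, which tends to infinity, leaves less than
  \<open>e\<close>.\<close>

lemma ln_z_lower_0:
  assumes f: "\<forall>\<^sub>F u in at_top. f u \<le> u / ln u" and "e > 0"
  shows "\<forall>\<^sub>F t in at_top. ln (x t) - e \<le> ln (z t)"
proof -
  obtain U where U: "\<And>u. U \<le> u \<Longrightarrow> f u \<le> 1 * u / ln u"
    using f by (auto simp: eventually_at_top_linorder)
  obtain c where c: "\<And>T. 0 \<le> T \<Longrightarrow> F_int f (x T) \<le> M * T + c" by (rule F_upper) blast
  have "\<forall>\<^sub>F t in at_top. z t > max U 1" "\<forall>\<^sub>F t in at_top. ln (x t) > 2 * c / e"
    using z_at_top ln_x_at_top by (simp_all only: filterlim_at_top_dense)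
  then show ?thesis using eventually_ge_at_top[of 0]
  proof eventually_elim
    case (elim t)
    show ?case
    proof (cases "z t \<le> x t")
      case True
      have "((ln (x t))\<^sup>2 - (ln (z t))\<^sup>2) / (2 * 1) \<le> F_int f (x t) - F_int f (z t)"
        using F_int_diff_ge_ln_squares[OF _ _ True, of 1] U elim by fastforce
      also have "\<dots> \<le> c" using c[of t] z_props[of t] elim by simp
      finally have *: "(ln (x t) - ln (z t)) * (ln (x t) + ln (z t)) \<le> 2 * c"
        by (simp add: power2_eq_square algebra_simps)
      have ln: "0 < ln (z t)" "ln (z t) \<le> ln (x t)" using elim True by auto
      have "(ln (x t) - ln (z t)) * ln (x t) \<le> (ln (x t) - ln (z t)) * (ln (x t) + ln (z t))"
        using ln by (intro mult_left_mono) auto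
      also have "\<dots> < e * ln (x t)" using * elim \<open>e > 0\<close> by (simp add: field_simps)
      finally show ?thesis using ln by simp
    next
      case False
      then have "ln (x t) \<le> ln (z t)" using x_pos[of t] elim by simp
      then show ?thesis using \<open>e > 0\<close> by simp
    qed
  qed
qed

section \<open>Limits of the quotient x(t) / z(t)\<close>

lemma x_over_z_eq:
  "\<forall>\<^sub>F t in at_top. exp (- (ln (z t) - ln (x t))) = x t / z t"
  using eventually_ge_at_top[of 0]
  by eventually_elim (simp add: exp_diff x_pos z_props)

lemma x_over_z_tendsto_0:
  assumes lam: "((\<lambda>y. ennreal (f y / (y / ln y))) \<longlongrightarrow> lam) at_top"
    and inf: "lam * (\<integral>\<^sup>+ s. ennreal s \<partial>\<mu>) = \<infinity>"
  shows "((\<lambda>t. x t / z t) \<longlongrightarrow> 0) at_top"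
proof -
  define C where "C = (\<integral>\<^sup>+ s. ennreal s \<partial>\<mu>)"
  have pos: "0 < lam" "0 < C" and top: "lam = top \<or> C = top"
    using inf by (auto simp: C_def ennreal_mult_eq_top_iff zero_less_iff_neq_zero)
  have "filterlim (\<lambda>t. ln (z t) - ln (x t)) at_top at_top"
    unfolding filterlim_at_top_ge[where c = 0]
  proof (intro allI impI)
    fix R :: real assume R: "R \<ge> 0"
    \<comment> \<open>One of \<open>lam\<close> and \<open>C\<close> is infinite and neither is 0:
      below the other any positive number is fixed, and the infinite one leaves room to make the
      product \<open>R + 1\<close>.\<close>
    obtain l \<kappa> where l: "0 < l" "ennreal l < lam" and \<kappa>: "0 < \<kappa>" "ennreal \<kappa> < C" and "R < l * \<kappa>"
    proof (cases "lam = top")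
      case True
      obtain \<kappa> where "0 < \<kappa>" "ennreal \<kappa> < C" using ennreal_pos_less_obtain[OF pos(2)] .
      then show ?thesis using that[of "(R + 1) / \<kappa>" \<kappa>] R True by simp
    next
      case False
      obtain l where "0 < l" "ennreal l < lam" using ennreal_pos_less_obtain[OF pos(1)] .
      then show ?thesis using that[of l "(R + 1) / l"] R False top by simp
    qed
    then have "\<forall>\<^sub>F t in at_top. ln (x t) + R \<le> ln (z t)"
      using R by (intro ln_z_lower[of l \<kappa>] f_ge_of_limit[OF lam]) (auto simp: C_def)
    then show "\<forall>\<^sub>F t in at_top. R \<le> ln (z t) - ln (x t)"
      by eventually_elim simp
  qed
  then have "filterlim (\<lambda>t. - (ln (z t) - ln (x t))) at_bot at_top"
    by (simp only: filterlim_uminus_at_top[symmetric])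
  then have "((\<lambda>t. exp (- (ln (z t) - ln (x t)))) \<longlongrightarrow> 0) at_top"
    by (rule filterlim_compose[OF exp_at_bot])
  then show ?thesis using x_over_z_eq by (rule Lim_transform_eventually)
qed

lemma x_over_z_tendsto_exp:
  assumes lam: "((\<lambda>y. ennreal (f y / (y / ln y))) \<longlongrightarrow> ennreal l) at_top" and l: "l \<ge> 0"
    and C: "(\<integral>\<^sup>+ s. ennreal s \<partial>\<mu>) = ennreal c" "c > 0"
  shows "((\<lambda>t. x t / z t) \<longlongrightarrow> exp (- (l * c))) at_top"
proof -
  have nonneg: "AE s in \<mu>. 0 \<le> s" by (rule AE_I2) (simp add: space_mu)
  have int: "integrable \<mu> (\<lambda>s. s)"
    by (rule integrableI_nonneg[OF ident_mu_measurable nonneg]) (simp add: C)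
  have c: "(\<integral>s. s \<partial>\<mu>) = c"
    using integral_eq_nn_integral[OF ident_mu_measurable nonneg] C by simp
  have "((\<lambda>t. ln (z t) - ln (x t)) \<longlongrightarrow> l * c) at_top"
  proof (rule order_tendstoI)
    fix a assume a: "a < l * c"
    show "\<forall>\<^sub>F t in at_top. a < ln (z t) - ln (x t)"
    proof (cases "l = 0")
      case True
      then have "\<forall>\<^sub>F t in at_top. ln (x t) - (- a / 2) \<le> ln (z t)"
        using a f_le_of_limit[OF lam, of 1] by (intro ln_z_lower_0) auto
      then show ?thesis by eventually_elim (use a True in simp)
    next
      case False
      \<comment> \<open>\<open>b\<close> lies strictly between \<open>a\<close> and
        \<open>l * c\<close> and is nonnegative, as \<open>ln_z_lower\<close> demands.\<close>
      define b where "b = max 0 ((a + l * c) / 2)"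
      have lc: "l * c > 0" using False l C by simp
      have b: "0 \<le> b" "a < b" "b < l * c" using a lc unfolding b_def max_def by (auto simp: field_simps)
      define y where "y = b / (l * c)"
      \<comment> \<open>Strictly smaller constants are needed, so \<open>l\<close> and
        \<open>c\<close> both shrink by \<open>\<rho>\<close>. The mean of 1 and \<open>y\<close>
        works since \<open>\<rho>\<^sup>2 - y = ((1 - y) / 2)\<^sup>2\<close>.\<close>
      define \<rho> where "\<rho> = (1 + y) / 2"
      have y: "0 \<le> y" "y < 1" "b = l * c * y" using b lc False C(2) by (auto simp: y_def)
      have \<rho>: "0 < \<rho>" "\<rho> < 1" using y by (auto simp: \<rho>_def)
      have "0 < ((1 - y) / 2)\<^sup>2" using y by simp
      also have "\<dots> = \<rho>\<^sup>2 - y" by (simp add: \<rho>_def power2_eq_square field_simps)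
      finally have "l * c * y < l * c * \<rho>\<^sup>2" using lc by (intro mult_strict_left_mono) simp_all
      then have "b < (\<rho> * l) * (\<rho> * c)" using y by (simp add: power2_eq_square mult_ac)
      moreover have "\<rho> * l < l" "\<rho> * c < c" using \<rho> l C(2) False by auto
      ultimately have "\<forall>\<^sub>F t in at_top. ln (x t) + b \<le> ln (z t)"
        using b \<rho> l C False
        by (intro ln_z_lower[of "\<rho> * l" "\<rho> * c"] f_ge_of_limit[OF lam]) (auto simp: ennreal_less_iff)
      then show ?thesis by eventually_elim (use b in simp)
    qed
  next
    fix a assume a: "l * c < a"
    \<comment> \<open>Both constants grow by \<open>e\<close>. As \<open>e \<le> 1\<close>, the
      product \<open>(l + e) * (c + e)\<close> exceeds \<open>l * c\<close> by at most
      \<open>e * (l + c + 1)\<close>, hence by at most half of \<open>a - l * c\<close>.\<close>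
    define e where "e = min 1 ((a - l * c) / (2 * (l + c + 1)))"
    have lc: "l + c + 1 > 0" using l C by simp
    have e: "0 < e" "e \<le> 1" using a lc by (auto simp: e_def)
    have "e \<le> (a - l * c) / (2 * (l + c + 1))" by (simp add: e_def)
    then have "e * (2 * (l + c + 1)) \<le> a - l * c"
      using lc pos_le_divide_eq[of "2 * (l + c + 1)" e "a - l * c"] by simp
    moreover have "e * e \<le> e * 1" using e by (intro mult_left_mono) auto
    moreover have "e * (l + c + 1) > 0" using e lc by simp
    ultimately have "(l + e) * (c + e) < a" by (simp add: algebra_simps)
    moreover have "\<forall>\<^sub>F t in at_top. ln (z t) \<le> ln (x t) + (l + e) * (c + e)"
      using e l c by (intro ln_z_upper f_le_of_limit[OF lam] int) (auto simp: ennreal_less_iff)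
    ultimately show "\<forall>\<^sub>F t in at_top. ln (z t) - ln (x t) < a"
      by (auto elim: eventually_mono)
  qed
  then have "((\<lambda>t. exp (- (ln (z t) - ln (x t)))) \<longlongrightarrow> exp (- (l * c))) at_top"
    by (intro tendsto_intros)
  then show ?thesis using x_over_z_eq by (rule Lim_transform_eventually)
qed

text \<open>The last assumption excludes \<open>lam = 0\<close> with \<open>C = \<infinity>\<close>,
  where the product in \<open>ennreal\<close> would be 0. Together with \<open>C > 0\<close> it
  makes both factors finite when the product is.\<close>

lemma x_over_z_tendsto:
  assumes lam: "((\<lambda>y. ennreal (f y / (y / ln y))) \<longlongrightarrow> lam) at_top"
    and C: "C = (\<integral>\<^sup>+ s. ennreal s \<partial>\<mu>)" "C > 0" and "C < \<infinity> \<or> lam > 0"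
  shows "((\<lambda>t. x t / F_inv f (M * t)) \<longlongrightarrow> exp_neg (lam * C)) at_top"
proof (cases "lam * C = \<infinity>")
  case True
  then show ?thesis using x_over_z_tendsto_0[OF lam] C by (simp add: exp_neg_def z_def)
next
  case False
  then have fin: "lam \<noteq> top" "C \<noteq> top"
    using assms(3,4) by (auto simp: ennreal_mult_eq_top_iff)
  obtain l where l: "lam = ennreal l" "l \<ge> 0" using fin(1) by (cases lam) auto
  obtain c where c: "C = ennreal c" "c \<ge> 0" using fin(2) by (cases C) auto
  have "exp_neg (lam * C) = exp (- (l * c))"
    using False l c by (simp add: exp_neg_def flip: ennreal_mult)
  moreover have "c > 0" using C(2) c by simp
  ultimately show ?thesis
    using x_over_z_tendsto_exp[of l c] lam C(1) l c by (simp add: z_def)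
qed

end

theorem theorem4:
  fixes f x :: "real \<Rightarrow> real" and \<mu> :: "real measure"
    and x\<^sub>1 \<psi> M :: real and lam C :: ennreal
  assumes f_C1: "f C1_differentiable_on {0<..}"
    and f_pos: "\<And>y. y > 0 \<Longrightarrow> f y > 0"
    and x1: "x\<^sub>1 \<ge> 0"
    and f'_pos: "\<And>y. y > x\<^sub>1 \<Longrightarrow> deriv f y > 0"
    and f'_lim: "(deriv f \<longlongrightarrow> 0) at_top"
    and lam: "((\<lambda>y. ennreal (f y / (y / ln y))) \<longlongrightarrow> lam) at_top"
    and mu_sets: "sets \<mu> = sets (restrict_space borel {0..})"
    and mu_finite: "finite_measure \<mu>"
    and M: "M = measure \<mu> {0..}" "M > 0"
    and C: "C = (\<integral>\<^sup>+ s. ennreal s \<partial>\<mu>)" "C > 0"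
    and psi: "\<psi> > 0"
    and x: "is_solution \<mu> f \<psi> x"
  shows "(filterlim x at_top at_top \<and> ((\<lambda>t. F_int f (x t) / t) \<longlongrightarrow> M) at_top)
    \<and> (C < \<infinity> \<longrightarrow> ((\<lambda>t. x t / F_inv f (M * t)) \<longlongrightarrow> exp_neg (lam * C)) at_top)
    \<and> (C = \<infinity> \<and> lam > 0 \<longrightarrow>
         ((\<lambda>t. x t / F_inv f (M * t)) \<longlongrightarrow> exp_neg (lam * C)) at_top)"
proof -
  interpret sublinear_rate f x\<^sub>1
    using f_C1 f_pos f'_pos f'_lim by unfold_locales
  obtain B where B: "B \<ge> 1" "\<And>u v. \<psi> \<le> u \<Longrightarrow> u \<le> v \<Longrightarrow> f u \<le> B * f v"
    using f_quasi_mono[OF psi] by metis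
  interpret delay_solution f x\<^sub>1 x \<mu> \<psi> M B
    by (intro delay_solution.intro delay_solution_axioms.intro sublinear_rate_axioms
        mu_sets mu_finite M psi x B)
  show ?thesis
    using x_at_top F_int_x_over_t x_over_z_tendsto[OF lam C] by blast
qed

end
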